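(* For all fixed positive integers $k$ and $l$, $$\frac{W_{k,l}}{\log n/n} \stackrel{p}{\longrightarrow} k+2l-1 \quad\text{as } n\to\infty ,$$ where $\stackrel{p}{\to}$ denotes convergence in probability and $$W_{k,l} := \max\{w(S) : S\subset V,\ v_1,v_2,\dots,v_k\in S,\ |S|=k+l\}$$ with $w(S)$ the weight of the minimum-weight Steiner tree connecting $S$ in the randomly weighted complete graph on $n$ vertices.
   Context: For each $n$ (large enough that $n\ge k+l$), let $G=(V,E)$ be the complete undirected graph on $n$ vertices $V=\{v_1,\dots,v_n\}$. Assign to its edges i.i.d. random weights having the exponential distribution with mean $1$; $T_{ij}=T_{ji}$ denotes the weight of the edge between $v_i$ and $v_j$. For $S\subset V$, $w(S)$ denotes the minimum, over all connected subgraphs of $G$ containing all vertices of $S$, of the total weight (sum of the edge weights) of the subgraph; the minimiser is almost surely a unique tree (the Steiner tree of $S$). $\log$ is the natural logarithm. *)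

theory Defs
  imports "HOL-Probability.Probability"
begin

(* Undirected edges are two-element sets of vertices, so that a weight function
   on edges is symmetric by construction. *)
definition complete_edges :: "'v set \<Rightarrow> 'v set set" where
  "complete_edges V = {e. e \<subseteq> V \<and> card e = 2}"

definition connected_graph :: "'v set \<Rightarrow> 'v set set \<Rightarrow> bool" where
  "connected_graph U F \<longleftrightarrow> U \<noteq> {} \<and> (\<forall>u\<in>U. \<forall>v\<in>U. (u, v) \<in> {(x, y). {x, y} \<in> F}\<^sup>*)"

definition connecting_subgraphs :: "'v set \<Rightarrow> 'v set \<Rightarrow> ('v set \<times> 'v set set) set" where
  "connecting_subgraphs V S =
     {(U, F). S \<subseteq> U \<and> U \<subseteq> V \<and> F \<subseteq> complete_edges U \<and> connected_graph U F}"

(* For finite V and nonempty S \<subseteq> V, Min is taken over a finite nonempty set. *)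
definition steiner_weight :: "'v set \<Rightarrow> ('v set \<Rightarrow> real) \<Rightarrow> 'v set \<Rightarrow> real" where
  "steiner_weight V T S = Min ((\<lambda>(U, F). \<Sum>e\<in>F. T e) ` connecting_subgraphs V S)"

(* The vertices are 1, ..., n. Max is taken over a nonempty set exactly when n \<ge> k + l. *)
definition max_steiner_weight :: "nat \<Rightarrow> nat \<Rightarrow> nat \<Rightarrow> (nat set \<Rightarrow> real) \<Rightarrow> real" where
  "max_steiner_weight k l n T =
     Max (steiner_weight {1..n} T ` {S. S \<subseteq> {1..n} \<and> {1..k} \<subseteq> S \<and> card S = k + l})"

(* Convergence in probability to a constant; the probability space may depend on n.
   Measurability is demanded because measure is 0 on non-measurable sets. *)
definition converges_in_prob :: "(nat \<Rightarrow> 'a measure) \<Rightarrow> (nat \<Rightarrow> 'a \<Rightarrow> real) \<Rightarrow> real \<Rightarrow> bool" where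
  "converges_in_prob M X c \<longleftrightarrow>
     (\<forall>\<^sub>F n in sequentially. X n \<in> borel_measurable (M n)) \<and>
     (\<forall>\<epsilon>>0. (\<lambda>n. measure (M n) {\<omega> \<in> space (M n). \<bar>X n \<omega> - c\<bar> > \<epsilon>}) \<longlonglongrightarrow> 0)"

end

(* The special vertices are those all of whose incident edges have weight at least (1 - th) ln n / n:
   their number is about n^th by Chebyshev. Choosing the l free terminals among them costs l extra
   units ln n / n, and the remaining weight is at least (k + l - 1) ln n / n by a Chernoff and first
   moment bound over the trees spanned by the terminals. Such a tree is traced by a walk that
   branches at most |S| - 1 times, so trees with e edges number at most n^e poly(e), and every
   prescribed vertex saves a factor n. The Chernoff weight with parameter lam of a tree with e edges
   is (1 + lam)^(-e), and lam just above n makes the sum over e converge.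

   For the upper bound it suffices to bound expectations: by subadditivity the maximum is at most
   the sum of the distances from 1 to 2, ..., k plus l times the largest distance from 1. The time
   during which the ball around 1 equals a given set A is, by the memoryless property, on average
   the probability that A occurs as a ball divided by |A|(n - |A|), and at most one set of each
   size occurs. Summing over A bounds the expected largest distance by the sum of 1/(j(n - j)),
   about 2 ln n / n, and the expected distance to a fixed vertex by about ln n / n.

   A lower bound in probability by c together with means tending to c gives convergence in
   probability. *)
theory Submission
  imports Defs "HOL-Real_Asymp.Real_Asymp"
begin

section \<open>Connected subgraphs and Steiner weights\<close>

text \<open>Which vertices are special depends on the weights, so the free terminals cannot be fixed
  in advance, and for small th a union bound over the roughly n^(th l) sets of \<open>l\<close>
  special vertices loses against a failure probability of n^(-th^2 (k + l - 1)). Counting avoids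
  this: if every Steiner weight were small, every \<open>l\<close>-set of special vertices would be
  heavy and cheap at once, while the expected number of such sets is a vanishing fraction of the
  expected number of heavy ones. So joint probabilities are bounded and nothing is conditioned.

  Walks are enumerated because a walk traces a tree by construction; no subtree of the optimal
  subgraph has to be extracted.

  Ball growth is handled without a process or stopping times. For a fixed set A, the time at which A
  is filled is a function of the edges inside A, and these are independent of the edges leaving A;
  the memoryless property becomes a Fubini computation over two blocks of edges.\<close>

lemma finite_complete_edges: "finite V \<Longrightarrow> finite (complete_edges V)"
  by (rule finite_subset[of _ "Pow V"]) (auto simp: complete_edges_def)

lemma complete_edges_mono: "A \<subseteq> B \<Longrightarrow> complete_edges A \<subseteq> complete_edges B"
  by (auto simp: complete_edges_def)

lemma pair_in_complete_edges: "{x, y} \<in> complete_edges V \<longleftrightarrow> x \<in> V \<and> y \<in> V \<and> x \<noteq> y"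
  by (auto simp: complete_edges_def card_2_iff doubleton_eq_iff)

lemma complete_edgesE:
  assumes "e \<in> complete_edges V"
  obtains x y where "e = {x, y}" "x \<in> V" "y \<in> V" "x \<noteq> y"
  using assms by (auto simp: complete_edges_def card_2_iff)

lemma edge_rel_sym: "sym ({(x, y). {x, y} \<in> F}\<^sup>*)"
  by (intro sym_rtrancl symI) (auto simp: insert_commute)

lemma connected_graphI_root:
  assumes "r \<in> U" "\<And>u. u \<in> U \<Longrightarrow> (r, u) \<in> {(x, y). {x, y} \<in> F}\<^sup>*"
  shows "connected_graph U F"
  unfolding connected_graph_def
  using assms edge_rel_sym[of F] by (auto dest: symD intro: rtrancl_trans)

lemma connected_graph_Un:
  assumes "connected_graph U F" "connected_graph U' F'" "r \<in> U" "r \<in> U'"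
  shows "connected_graph (U \<union> U') (F \<union> F')"
proof (rule connected_graphI_root[of r])
  show "r \<in> U \<union> U'" using assms by simp
  fix u assume "u \<in> U \<union> U'"
  then have "(r, u) \<in> {(x, y). {x, y} \<in> F}\<^sup>* \<or> (r, u) \<in> {(x, y). {x, y} \<in> F'}\<^sup>*"
    using assms unfolding connected_graph_def by blast
  moreover have "{(x, y). {x, y} \<in> F} \<subseteq> {(x, y). {x, y} \<in> F \<union> F'}"
    "{(x, y). {x, y} \<in> F'} \<subseteq> {(x, y). {x, y} \<in> F \<union> F'}" by auto
  ultimately show "(r, u) \<in> {(x, y). {x, y} \<in> F \<union> F'}\<^sup>*"
    using rtrancl_mono by blast
qed

lemma connected_graph_insert:
  assumes "connected_graph U F" "a \<in> U"
  shows "connected_graph (insert b U) (insert {a, b} F)"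
proof -
  have "connected_graph {a, b} {{a, b}}"
    by (rule connected_graphI_root[of a]) auto
  from connected_graph_Un[OF assms(1) this assms(2)] assms(2) show ?thesis
    by (simp add: insert_absorb)
qed

lemma finite_connecting_subgraphs: "finite V \<Longrightarrow> finite (connecting_subgraphs V S)"
  by (rule finite_subset[of _ "Pow V \<times> Pow (complete_edges V)"])
    (use complete_edges_mono[THEN subsetD] in \<open>fastforce simp: connecting_subgraphs_def finite_complete_edges\<close>)+

lemma connecting_subgraphs_edges:
  "(U, F) \<in> connecting_subgraphs V S \<Longrightarrow> F \<subseteq> complete_edges V"
  using complete_edges_mono by (fastforce simp: connecting_subgraphs_def)

lemma connecting_subgraphs_mono:
  "S' \<subseteq> S \<Longrightarrow> V \<subseteq> V' \<Longrightarrow> connecting_subgraphs V S \<subseteq> connecting_subgraphs V' S'"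
  by (auto simp: connecting_subgraphs_def)

lemma complete_graph_connecting:
  assumes "S \<subseteq> V" "V \<noteq> {}"
  shows "(V, complete_edges V) \<in> connecting_subgraphs V S"
proof -
  have "(u, v) \<in> {(x, y). {x, y} \<in> complete_edges V}\<^sup>*" if "u \<in> V" "v \<in> V" for u v
    using that by (cases "u = v") (auto simp: pair_in_complete_edges)
  then show ?thesis using assms by (auto simp: connecting_subgraphs_def connected_graph_def)
qed

lemma steiner_weight_le:
  assumes "finite V" "(U, F) \<in> connecting_subgraphs V S"
  shows "steiner_weight V T S \<le> sum T F"
  unfolding steiner_weight_def
  using assms by (intro Min_le finite_imageI finite_connecting_subgraphs) force+

lemma steiner_weight_attained:
  assumes "finite V" "S \<subseteq> V" "V \<noteq> {}"
  obtains U F where "(U, F) \<in> connecting_subgraphs V S" "steiner_weight V T S = sum T F"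
proof -
  have "steiner_weight V T S \<in> (\<lambda>(U, F). sum T F) ` connecting_subgraphs V S"
    unfolding steiner_weight_def
    using assms complete_graph_connecting[OF assms(2,3)]
    by (intro Min_in finite_imageI finite_connecting_subgraphs) auto
  then show thesis using that by auto
qed

lemma steiner_weight_cong:
  assumes "\<And>e. e \<in> complete_edges V \<Longrightarrow> T e = T' e"
  shows "steiner_weight V T S = steiner_weight V T' S"
  unfolding steiner_weight_def
proof (intro arg_cong[where f = Min] image_cong refl, clarify)
  fix U F assume "(U, F) \<in> connecting_subgraphs V S"
  from connecting_subgraphs_edges[OF this] show "sum T F = sum T' F"
    by (intro sum.cong) (auto intro: assms)
qed

lemma steiner_weight_nonneg:
  assumes "finite V" "S \<subseteq> V" "V \<noteq> {}" "\<And>e. e \<in> complete_edges V \<Longrightarrow> T e \<ge> 0"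
  shows "steiner_weight V T S \<ge> 0"
proof -
  obtain U F where "(U, F) \<in> connecting_subgraphs V S" "steiner_weight V T S = sum T F"
    using steiner_weight_attained[OF assms(1-3)] by blast
  with connecting_subgraphs_edges[OF this(1)] show ?thesis
    by (auto intro!: sum_nonneg assms(4))
qed

text \<open>Optimal subgraphs for the pairs \<open>{r, v}\<close> share \<open>r\<close>, so their
  union is connected; as weights are nonnegative, edges used twice only lower the total.\<close>

lemma steiner_weight_le_sum_dist:
  assumes V: "finite V" "r \<in> V" and R: "R \<subseteq> V"
    and T: "\<And>e. e \<in> complete_edges V \<Longrightarrow> T e \<ge> 0"
  shows "steiner_weight V T (insert r R) \<le> (\<Sum>v\<in>R. steiner_weight V T {r, v})"
proof -
  from R V have "finite R" by (auto intro: finite_subset)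
  from this R have "\<exists>U F. (U, F) \<in> connecting_subgraphs V (insert r R) \<and>
      sum T F \<le> (\<Sum>v\<in>R. steiner_weight V T {r, v})"
  proof (induction R)
    case empty
    show ?case using V
      by (intro exI[of _ "{r}"] exI[of _ "{}"]) (auto simp: connecting_subgraphs_def connected_graph_def)
  next
    case (insert q R)
    then obtain U F where UF: "(U, F) \<in> connecting_subgraphs V (insert r R)"
      "sum T F \<le> (\<Sum>v\<in>R. steiner_weight V T {r, v})" by auto
    obtain U' F' where UF': "(U', F') \<in> connecting_subgraphs V {r, q}"
      "steiner_weight V T {r, q} = sum T F'"
      using steiner_weight_attained[of V "{r, q}" T] insert.prems V by auto
    have *: "(U \<union> U', F \<union> F') \<in> connecting_subgraphs V (insert r (insert q R))"
    proof -
      have "connected_graph (U \<union> U') (F \<union> F')"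
        using UF(1) UF'(1) by (intro connected_graph_Un[where r = r]) (auto simp: connecting_subgraphs_def)
      then show ?thesis using UF(1) UF'(1)
        complete_edges_mono[of U "U \<union> U'"] complete_edges_mono[of U' "U \<union> U'"]
        by (auto simp: connecting_subgraphs_def)
    qed
    have fin: "finite F" "finite F'" "F \<subseteq> complete_edges V" "F' \<subseteq> complete_edges V"
      using UF(1) UF'(1) connecting_subgraphs_edges finite_complete_edges[OF V(1)]
      by (meson finite_subset)+
    have "sum T (F \<union> F') \<le> sum T F + sum T F'"
      using sum.union_inter[OF fin(1,2), of T] sum_nonneg[of "F \<inter> F'" T] fin T
      by (auto simp: subset_iff)
    with UF UF' * insert.hyps show ?case
      by (intro exI[of _ "U \<union> U'"] exI[of _ "F \<union> F'"]) auto
  qed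
  then show ?thesis using steiner_weight_le[OF V(1)] by (meson order_trans)
qed

text \<open>Transports an optimal subgraph along the permutation. One inequality is enough for the
  exchange argument, where \<open>p\<close> is a transposition of vertices.\<close>

lemma steiner_weight_image_le:
  assumes V: "finite V" "V \<noteq> {}" "S \<subseteq> V" and p: "bij_betw p V V"
  shows "steiner_weight V T (p ` S) \<le> steiner_weight V (\<lambda>e. T (p ` e)) S"
proof -
  obtain U F where UF: "(U, F) \<in> connecting_subgraphs V S"
    "steiner_weight V (\<lambda>e. T (p ` e)) S = (\<Sum>e\<in>F. T (p ` e))"
    using steiner_weight_attained[OF V(1,3,2)] by blast
  have inj: "inj_on p V" and img: "p ` V = V" using p by (auto simp: bij_betw_def)
  have F: "F \<subseteq> complete_edges U" "U \<subseteq> V" "S \<subseteq> U" "connected_graph U F"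
    using UF(1) by (auto simp: connecting_subgraphs_def)
  have "inj_on ((`) p) F"
    using F(1,2) by (intro inj_onI, subst (asm) inj_on_image_eq_iff[OF inj]) (auto simp: complete_edges_def)
  then have "(\<Sum>e\<in>F. T (p ` e)) = sum T ((`) p ` F)" by (simp add: sum.reindex)
  moreover have "(p ` U, (`) p ` F) \<in> connecting_subgraphs V (p ` S)"
  proof -
    have "(p u, p v) \<in> {(x, y). {x, y} \<in> (`) p ` F}\<^sup>*"
      if "(u, v) \<in> {(x, y). {x, y} \<in> F}\<^sup>*" for u v
      using that
    proof induction
      case (step y z)
      then have "{p y, p z} \<in> (`) p ` F" by (auto intro: rev_image_eqI)
      with step.IH show ?case by (auto intro: rtrancl_into_rtrancl)
    qed auto
    then have "connected_graph (p ` U) ((`) p ` F)"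
      using F(4) by (auto simp: connected_graph_def)
    moreover have "(`) p ` F \<subseteq> complete_edges (p ` U)"
    proof clarify
      fix e assume "e \<in> F"
      then show "p ` e \<in> complete_edges (p ` U)"
        using F(1,2) inj card_image[OF inj_on_subset[OF inj, of e]]
        by (auto simp: complete_edges_def subset_iff)
    qed
    moreover have "p ` U \<subseteq> V" using F(2) img by blast
    ultimately show ?thesis using F(3) by (auto simp: connecting_subgraphs_def)
  qed
  ultimately show ?thesis using steiner_weight_le[OF V(1)] UF(2) by metis
qed

section \<open>Counting trees through prescribed vertices\<close>

text \<open>The walk \<open>branching_walk r j U F x\<close> has visited \<open>U\<close> through the edges \<open>F\<close>, stands at \<open>x\<close>,
  and has jumped back to a visited vertex \<open>j\<close> times.\<close>

inductive branching_walk :: "'v \<Rightarrow> nat \<Rightarrow> 'v set \<Rightarrow> 'v set set \<Rightarrow> 'v \<Rightarrow> bool" for r where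
  start: "branching_walk r 0 {r} {} r"
| extend: "branching_walk r j U F x \<Longrightarrow> y \<notin> U \<Longrightarrow>
    branching_walk r j (insert y U) (insert {x, y} F) y"
| jump: "branching_walk r j U F x \<Longrightarrow> u \<in> U \<Longrightarrow> branching_walk r (Suc j) U F u"

lemma branching_walk_basic:
  assumes "branching_walk r j U F x"
  shows "finite U" "r \<in> U" "x \<in> U" "finite F" "F \<subseteq> complete_edges U" "card U = Suc (card F)"
proof -
  have "finite U \<and> r \<in> U \<and> x \<in> U \<and> finite F \<and> F \<subseteq> complete_edges U \<and> card U = Suc (card F)"
    using assms
  proof induction
    case (extend j U F x y)
    then have "{x, y} \<notin> F" by (auto simp: complete_edges_def)
    moreover have "{x, y} \<in> complete_edges (insert y U)"
      using extend by (auto simp: pair_in_complete_edges)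
    ultimately show ?case using extend complete_edges_mono[of U "insert y U"] by auto
  qed auto
  then show "finite U" "r \<in> U" "x \<in> U" "finite F" "F \<subseteq> complete_edges U" "card U = Suc (card F)"
    by auto
qed

text \<open>Each vertex other than \<open>r\<close> is entered through the edge added together with
  it, and these edges are distinct. For special terminals \<open>Q\<close>, every such edge carries
  weight at least \<open>a\<close>.\<close>

lemma branching_walk_touching:
  assumes "branching_walk r j U F x" "Q \<subseteq> U - {r}"
  shows "card Q \<le> card {e \<in> F. e \<inter> Q \<noteq> {}}"
  using assms
proof (induction arbitrary: Q)
  case (extend j U F x y Q)
  note b = branching_walk_basic[OF extend.hyps(1)]
  have new: "{x, y} \<notin> F" using b extend.hyps(2) by (auto simp: complete_edges_def)
  have le: "card (Q - {y}) \<le> card {e \<in> F. e \<inter> (Q - {y}) \<noteq> {}}"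
    using extend.prems by (intro extend.IH) auto
  show ?case
  proof (cases "y \<in> Q")
    case True
    have finQ: "finite Q" using extend.prems b(1) by (auto intro: finite_subset)
    have "card Q = Suc (card (Q - {y}))" using True finQ by (metis card.remove)
    also have "\<dots> \<le> Suc (card {e \<in> F. e \<inter> (Q - {y}) \<noteq> {}})" using le by simp
    also have "\<dots> = card (insert {x, y} {e \<in> F. e \<inter> (Q - {y}) \<noteq> {}})" using b new by simp
    also have "\<dots> \<le> card {e \<in> insert {x, y} F. e \<inter> Q \<noteq> {}}"
      using b True by (intro card_mono) auto
    finally show ?thesis .
  next
    case False
    then have "card Q \<le> card {e \<in> F. e \<inter> Q \<noteq> {}}" using le by simp
    also have "\<dots> \<le> card {e \<in> insert {x, y} F. e \<inter> Q \<noteq> {}}"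
      using b by (intro card_mono) auto
    finally show ?thesis .
  qed
qed auto

text \<open>One jump suffices: return to the visited vertex nearest to \<open>q\<close> and follow a
  shortest path, all of whose later vertices are unvisited.\<close>

lemma branching_walk_reach:
  assumes conn: "connected_graph U0 F0" and q: "q \<in> U0" and r: "r \<in> U0"
    and bw: "branching_walk r j U F x" and F: "F \<subseteq> F0"
  obtains U' F' where "branching_walk r (Suc j) U' F' q" "U \<subseteq> U'" "F' \<subseteq> F0"
proof -
  define E where "E = {(x, y). {x, y} \<in> F0}"
  \<comment> \<open>The vertices within \<open>m\<close> steps of \<open>U\<close>. Keeping
    \<open>U'\<close> inside \<open>layer m\<close> ensures that a vertex first met in
    \<open>layer (Suc m)\<close> is new to the walk, as \<open>extend\<close> requires.\<close>
  define layer where "layer m = ((\<lambda>A. A \<union> E `` A) ^^ m) U" for m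
  have ex: "\<exists>U' F'. branching_walk r (Suc j) U' F' q \<and> U \<subseteq> U' \<and> F' \<subseteq> F0 \<and> U' \<subseteq> layer m"
    if "q \<in> layer m" for m q
    using that
  proof (induction m arbitrary: q)
    case 0
    then have "branching_walk r (Suc j) U F q"
      using bw by (auto simp: layer_def intro: branching_walk.jump)
    then show ?case using F by (auto simp: layer_def)
  next
    case (Suc m)
    have step: "layer (Suc m) = layer m \<union> E `` layer m" by (simp add: layer_def)
    show ?case
    proof (cases "q \<in> layer m")
      case True
      with Suc.IH step show ?thesis by blast
    next
      case False
      with Suc.prems step obtain p where p: "p \<in> layer m" "(p, q) \<in> E" by auto
      from Suc.IH[OF p(1)] obtain U' F' where
        *: "branching_walk r (Suc j) U' F' p" "U \<subseteq> U'" "F' \<subseteq> F0" "U' \<subseteq> layer m" by blast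
      from *(4) False have "q \<notin> U'" by auto
      from branching_walk.extend[OF *(1) this] * p Suc.prems step show ?thesis
        by (intro exI[of _ "insert q U'"] exI[of _ "insert {p, q} F'"]) (auto simp: E_def)
    qed
  qed
  have "\<exists>m. q \<in> layer m" if "(r, q) \<in> E\<^sup>*" for q
    using that
  proof induction
    case base
    show ?case using branching_walk_basic(2)[OF bw] by (intro exI[of _ 0]) (simp add: layer_def)
  next
    case (step y z)
    then obtain m where "y \<in> layer m" by auto
    with step show ?case by (intro exI[of _ "Suc m"]) (auto simp: layer_def)
  qed
  moreover have "(r, q) \<in> E\<^sup>*" using conn q r by (auto simp: connected_graph_def E_def)
  ultimately show thesis using ex that by blast
qed

text \<open>One jump per terminal, so the number of jumps does not depend on the size of the
  subgraph. Since \<open>F \<subseteq> F0\<close>, the traced tree is no heavier than the subgraph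
  when weights are nonnegative.\<close>

lemma branching_walk_exists:
  assumes conn: "connected_graph U0 F0" and r: "r \<in> U0" and R: "finite R" "R \<subseteq> U0"
  shows "\<exists>U F x. branching_walk r (card R) U F x \<and> R \<subseteq> U \<and> F \<subseteq> F0"
  using R
proof (induction R)
  case empty
  show ?case using branching_walk.start[of r] by (intro exI[of _ "{r}"] exI[of _ "{}"]) auto
next
  case (insert q R)
  then obtain U F x where "branching_walk r (card R) U F x" "R \<subseteq> U" "F \<subseteq> F0" by auto
  moreover from branching_walk_reach[OF conn _ r this(1,3)] insert.prems
  obtain U' F' where "branching_walk r (Suc (card R)) U' F' q" "U \<subseteq> U'" "F' \<subseteq> F0" by blast
  ultimately show ?case using insert.hyps branching_walk_basic(3)
    by (intro exI[of _ U'] exI[of _ F'] exI[of _ q]) auto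
qed

text \<open>The order of visits is forgotten, which keeps the count small; the endpoint is kept
  because the next edge starts there.\<close>

definition branching_walks :: "'v set \<Rightarrow> 'v \<Rightarrow> nat \<Rightarrow> nat \<Rightarrow> 'v set \<Rightarrow> ('v set \<times> 'v set set \<times> 'v) set" where
  "branching_walks V r j e R =
     {(U, F, x). branching_walk r j U F x \<and> U \<subseteq> V \<and> card F = e \<and> R \<subseteq> U}"

lemma finite_branching_walks:
  assumes "finite V"
  shows "finite (branching_walks V r j e R)"
proof (rule finite_subset)
  show "branching_walks V r j e R \<subseteq> Pow V \<times> Pow (complete_edges V) \<times> V"
  proof
    fix t assume "t \<in> branching_walks V r j e R"
    then obtain U F x where t: "t = (U, F, x)" "branching_walk r j U F x" "U \<subseteq> V"
      by (auto simp: branching_walks_def)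
    from branching_walk_basic(3,5)[OF t(2)] complete_edges_mono[OF t(3)] t(3)
    show "t \<in> Pow V \<times> Pow (complete_edges V) \<times> V" by (auto simp: t(1))
  qed
  show "finite (Pow V \<times> Pow (complete_edges V) \<times> V)"
    using assms by (simp add: finite_complete_edges)
qed

lemma branching_walks_0:
  assumes "r \<notin> R"
  shows "card (branching_walks V r j 0 R) \<le> 1" "R \<noteq> {} \<Longrightarrow> branching_walks V r j 0 R = {}"
proof -
  have *: "U = {r} \<and> F = {} \<and> x = r" if "branching_walk r j U F x" "card F = 0" for U F x
  proof -
    note b = branching_walk_basic[OF that(1)]
    with that(2) have "card U = 1" "F = {}" by auto
    with b show ?thesis by (auto simp: card_1_singleton_iff)
  qed
  then have "branching_walks V r j 0 R \<subseteq> {({r}, {}, r)}"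
    by (auto simp: branching_walks_def)
  then show "card (branching_walks V r j 0 R) \<le> 1"
    using card_mono[of "{({r}, {}, r)}" "branching_walks V r j 0 R"] by simp
  show "branching_walks V r j 0 R = {}" if "R \<noteq> {}"
    using assms that by (auto simp: branching_walks_def dest!: *)
qed

text \<open>By the last step. An extension to a vertex outside \<open>R\<close> has at most
  \<open>card V\<close> choices; an extension to some \<open>y\<close> in \<open>R\<close> has only
  \<open>card R\<close> choices, and \<open>y\<close> was not yet required before it; a jump has as
  targets the \<open>e + 2\<close> vertices visited by a walk with \<open>e + 1\<close>
  edges.\<close>

lemma branching_walks_Suc:
  assumes V: "finite V" and R: "R \<subseteq> V"
  shows "card (branching_walks V r j (Suc e) R) \<le>
    card V * card (branching_walks V r j e R) + (\<Sum>y\<in>R. card (branching_walks V r j e (R - {y})))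
    + (if j = 0 then 0 else (e + 2) * card (branching_walks V r (j - 1) (Suc e) R))"
proof -
  let ?C = "\<lambda>j e R. branching_walks V r j e R"
  let ?ext = "\<lambda>y (U, F, x). (insert y U, insert {x, y} F, y)"
  let ?J = "if j = 0 then {} else (\<lambda>((U, F, x), u). (U, F, u)) ` (SIGMA t:?C (j - 1) (Suc e) R. fst t)"
  have finR: "finite R" using R V finite_subset by blast
  have sub: "?C j (Suc e) R \<subseteq> (\<lambda>(y, t). ?ext y t) ` (V \<times> ?C j e R)
      \<union> (\<Union>y\<in>R. ?ext y ` ?C j e (R - {y})) \<union> ?J"
  proof
    fix t assume t: "t \<in> ?C j (Suc e) R"
    obtain U F x where t_eq: "t = (U, F, x)" by (cases t)
    have bw: "branching_walk r j U F x" and UV: "U \<subseteq> V" and cF: "card F = Suc e" and RU: "R \<subseteq> U"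
      using t by (auto simp: branching_walks_def t_eq)
    from bw show "t \<in> (\<lambda>(y, t). ?ext y t) ` (V \<times> ?C j e R)
      \<union> (\<Union>y\<in>R. ?ext y ` ?C j e (R - {y})) \<union> ?J"
    proof cases
      case start
      with cF show ?thesis by simp
    next
      case (extend U' F' x')
      note b = branching_walk_basic[OF extend(3)]
      have "{x', x} \<notin> F'" using b extend by (auto simp: complete_edges_def)
      then have cF': "card F' = e" using cF extend b by simp
      show ?thesis
      proof (cases "x \<in> R")
        case True
        have "(U', F', x') \<in> ?C j e (R - {x})"
          using extend UV RU cF' by (auto simp: branching_walks_def)
        then have "t \<in> ?ext x ` ?C j e (R - {x})" using extend
          by (intro image_eqI[of _ _ "(U', F', x')"]) (auto simp: t_eq)
        then show ?thesis using True by blast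
      next
        case False
        have "(U', F', x') \<in> ?C j e R"
          using extend UV RU cF' False by (auto simp: branching_walks_def)
        then have "t \<in> (\<lambda>(y, t). ?ext y t) ` (V \<times> ?C j e R)" using extend UV
          by (intro image_eqI[of _ _ "(x, (U', F', x'))"]) (auto simp: t_eq)
        then show ?thesis by blast
      qed
    next
      case (jump j' x')
      have "((U, F, x'), x) \<in> (SIGMA t:?C (j - 1) (Suc e) R. fst t)"
        using jump UV cF RU by (auto simp: branching_walks_def)
      then have "t \<in> (\<lambda>((U, F, x), u). (U, F, u)) ` (SIGMA t:?C (j - 1) (Suc e) R. fst t)"
        by (intro image_eqI[of _ _ "((U, F, x'), x)"]) (auto simp: t_eq)
      then show ?thesis using jump by simp
    qed
  qed
  have fin: "finite (?C j e R)" for j e R by (rule finite_branching_walks[OF V])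
  have finU: "finite (fst t)" "card (fst t) = Suc e'" if "t \<in> ?C j e' R" for t j e'
    using that branching_walk_basic(1,6) by (auto simp: branching_walks_def)
  have 1: "card ((\<lambda>(y, t). ?ext y t) ` (V \<times> ?C j e R)) \<le> card V * card (?C j e R)"
    using card_image_le[of "V \<times> ?C j e R" "\<lambda>(y, t). ?ext y t"] V fin[of j e R] by simp
  have 2: "card (\<Union>y\<in>R. ?ext y ` ?C j e (R - {y})) \<le> (\<Sum>y\<in>R. card (?C j e (R - {y})))"
    by (rule order_trans[OF card_UN_le[OF finR] sum_mono[OF card_image_le[OF fin]]])
  have 3: "card ?J \<le> (if j = 0 then 0 else (e + 2) * card (?C (j - 1) (Suc e) R))"
  proof -
    have "card (SIGMA t:?C (j - 1) (Suc e) R. fst t) = (\<Sum>t\<in>?C (j - 1) (Suc e) R. card (fst t))"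
      by (rule card_SigmaI) (auto intro: fin finU)
    also have "\<dots> = (\<Sum>t\<in>?C (j - 1) (Suc e) R. e + 2)"
      by (intro sum.cong) (auto simp: finU(2)[of _ _ "Suc e"])
    finally have "card (SIGMA t:?C (j - 1) (Suc e) R. fst t) = (e + 2) * card (?C (j - 1) (Suc e) R)"
      by simp
    moreover have "finite (SIGMA t:?C (j - 1) (Suc e) R. fst t)"
      by (intro finite_SigmaI fin finU(1))
    ultimately show ?thesis
      using card_image_le[of "SIGMA t:?C (j - 1) (Suc e) R. fst t" "\<lambda>((U, F, x), u). (U, F, u)"] by simp
  qed
  have 4: "finite ((\<lambda>(y, t). ?ext y t) ` (V \<times> ?C j e R)
      \<union> (\<Union>y\<in>R. ?ext y ` ?C j e (R - {y})) \<union> ?J)"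
    using V finR fin finU(1) by (auto intro!: finite_SigmaI)
  have 5: "card (?C j (Suc e) R) \<le> card A + card B + card J"
    if "?C j (Suc e) R \<subseteq> A \<union> B \<union> J" "finite (A \<union> B \<union> J)" for A B J
    using card_mono[OF that(2,1)] card_Un_le[of "A \<union> B" J] card_Un_le[of A B] by linarith
  show ?thesis
    by (rule order_trans[OF 5[OF sub 4] add_mono[OF add_mono[OF 1 2] 3]])
qed

text \<open>The polynomial part of the induction in \<open>card_branching_walks\<close>; the
  summands stem from extensions to free vertices, extensions to prescribed vertices, and jumps.
  Splitting one factor \<open>e + 2\<close> into \<open>e + 1\<close> and 1 leaves the 1 for the
  jumps, while a Bernoulli inequality absorbs the other two summands. This is why the exponent has 2
  per jump and per prescribed vertex.\<close>

lemma branching_walks_arith: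
  fixes e i j :: nat
  assumes "i + j > 0"
  shows "(e + 1) ^ (2 * (j + i)) + i * (e + 1) ^ (2 * (j + i) - 2) + (e + 2) ^ (2 * (j + i) - 1)
    \<le> (e + 2) ^ (2 * (j + i))"
proof -
  define M where "M = 2 * (j + i) - 2"
  have M: "2 * (j + i) = M + 2" "i \<le> M + 1" using assms by (auto simp: M_def)
  have bern: "(e + 1) ^ (M + 1) + (M + 1) * (e + 1) ^ M \<le> (e + 2) ^ (M + 1)"
  proof (induction M)
    case (Suc M)
    have "(e + 1) ^ (Suc M + 1) + (Suc M + 1) * (e + 1) ^ Suc M
      \<le> (e + 2) * ((e + 1) ^ (M + 1) + (M + 1) * (e + 1) ^ M)" by (simp add: algebra_simps)
    also have "\<dots> \<le> (e + 2) * (e + 2) ^ (M + 1)" using Suc by (intro mult_left_mono) auto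
    finally show ?case by simp
  qed simp
  have "(e + 1) ^ (M + 2) + i * (e + 1) ^ M \<le> (e + 1) ^ (M + 2) + (M + 1) * (e + 1) ^ M * (e + 1)"
    using mult_mono[OF M(2), of "(e + 1) ^ M" "(e + 1) ^ M * (e + 1)"] by (simp add: algebra_simps)
  also have "\<dots> = (e + 1) * ((e + 1) ^ (M + 1) + (M + 1) * (e + 1) ^ M)" by (simp add: algebra_simps)
  also have "\<dots> \<le> (e + 1) * (e + 2) ^ (M + 1)" by (intro mult_left_mono bern) simp
  finally have "(e + 1) ^ (M + 2) + i * (e + 1) ^ M + (e + 2) ^ (M + 1) \<le> (e + 2) * (e + 2) ^ (M + 1)"
    by simp
  then show ?thesis unfolding M(1) by simp
qed

lemma card_branching_walks:
  assumes V: "finite V" and R: "R \<subseteq> V - {r}"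
  shows "card V ^ card R * card (branching_walks V r j e R) \<le> card V ^ e * (e + 1) ^ (2 * (j + card R))"
  using R
\<comment> \<open>Undoing an extension lowers \<open>e\<close>, undoing a jump lowers
  \<open>j\<close>.\<close>
proof (induction "j + e" arbitrary: j e R rule: less_induct)
  case less
  note IH = less.hyps
  show ?case
  proof (cases e)
    case 0
    then show ?thesis using branching_walks_0(1)[of r R V j] branching_walks_0(2)[of r R V j] less.prems
      by (cases "R = {}") (simp, force)
  next
    case (Suc d)
    let ?n = "card V" and ?i = "card R" and ?c = "\<lambda>j e R. card (branching_walks V r j e R)"
    have finR: "finite R" using less.prems V finite_subset by blast
    have 1: "?n ^ ?i * (?n * ?c j d R) \<le> ?n ^ Suc d * (d + 1) ^ (2 * (j + ?i))"
      using IH[of j d R] less.prems Suc by (simp add: mult.left_commute mult.assoc)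
    have 2: "?n ^ ?i * (\<Sum>y\<in>R. ?c j d (R - {y})) \<le> ?n ^ Suc d * (?i * (d + 1) ^ (2 * (j + ?i) - 2))"
    proof -
      have "?n ^ ?i * ?c j d (R - {y}) \<le> ?n ^ Suc d * (d + 1) ^ (2 * (j + ?i) - 2)" if "y \<in> R" for y
      proof -
        have c: "?i = Suc (card (R - {y}))" using that finR by (metis card.remove)
        have "?n ^ card (R - {y}) * ?c j d (R - {y}) \<le> ?n ^ d * (d + 1) ^ (2 * (j + card (R - {y})))"
          using less.prems Suc by (intro IH) auto
        then show ?thesis unfolding c by (simp add: mult.assoc)
      qed
      then have "(\<Sum>y\<in>R. ?n ^ ?i * ?c j d (R - {y})) \<le> (\<Sum>y\<in>R. ?n ^ Suc d * (d + 1) ^ (2 * (j + ?i) - 2))"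
        by (rule sum_mono)
      then show ?thesis by (simp add: sum_distrib_left mult_ac)
    qed
    let ?J = "if j = 0 then 0 else (d + 2) * ?c (j - 1) (Suc d) R"
    have "?n ^ ?i * ?c j (Suc d) R \<le> ?n ^ ?i * (?n * ?c j d R + (\<Sum>y\<in>R. ?c j d (R - {y})) + ?J)"
      using less.prems by (intro mult_left_mono branching_walks_Suc[OF V]) auto
    also have "\<dots> \<le> ?n ^ Suc d * (d + 2) ^ (2 * (j + ?i))"
    proof (cases "?i + j = 0")
      case True
      then have "R = {}" "j = 0" using finR by auto
      then show ?thesis using 1 by simp
    next
      case False
      have 3: "?n ^ ?i * ?J \<le> ?n ^ Suc d * (d + 2) ^ (2 * (j + ?i) - 1)"
      proof (cases j)
        case (Suc j')
        have J: "?J = (d + 2) * ?c j' (Suc d) R" and p: "2 * (j + ?i) - 1 = Suc (2 * (j' + ?i))"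
          using Suc by simp_all
        have "(d + 2) * (?n ^ ?i * ?c j' (Suc d) R) \<le> (d + 2) * (?n ^ Suc d * (Suc d + 1) ^ (2 * (j' + ?i)))"
          using Suc \<open>e = Suc d\<close> less.prems by (intro mult_left_mono IH) auto
        also have "\<dots> = ?n ^ Suc d * (d + 2) ^ (2 * (j + ?i) - 1)"
          unfolding p by (simp only: power_Suc mult.left_commute) simp
        finally show ?thesis unfolding J by (simp only: mult.left_commute)
      qed simp
      have "?n ^ ?i * (?n * ?c j d R + (\<Sum>y\<in>R. ?c j d (R - {y})) + ?J) \<le>
        ?n ^ Suc d * ((d + 1) ^ (2 * (j + ?i)) + ?i * (d + 1) ^ (2 * (j + ?i) - 2) + (d + 2) ^ (2 * (j + ?i) - 1))"
        unfolding distrib_left using 1 2 3 by (intro add_mono) (simp_all add: distrib_left)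
      also have "\<dots> \<le> ?n ^ Suc d * (d + 2) ^ (2 * (j + ?i))"
        using False by (intro mult_left_mono branching_walks_arith) auto
      finally show ?thesis .
    qed
    finally show ?thesis using Suc by simp
  qed
qed

section \<open>The lower bound\<close>

lemma borel_measurable_steiner_weight:
  assumes "finite A" "\<And>e. e \<in> complete_edges A \<Longrightarrow> (\<lambda>x. X x e) \<in> borel_measurable N"
  shows "(\<lambda>x. steiner_weight A (X x) S) \<in> borel_measurable N"
  unfolding steiner_weight_def
proof (intro borel_measurable_Min finite_connecting_subgraphs assms(1))
  fix g assume "g \<in> connecting_subgraphs A S"
  then show "(\<lambda>x. case g of (U, F) \<Rightarrow> sum (X x) F) \<in> borel_measurable N"
    using connecting_subgraphs_edges by (cases g) (force intro!: borel_measurable_sum assms(2))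
qed

section \<open>Exponential weights: truncated transforms and the Chernoff bound\<close>

locale exponential_weights = prob_space M for M :: "'a measure" +
  fixes V :: "'v set" and T :: "'v set \<Rightarrow> 'a \<Rightarrow> real"
  assumes finite_vertices: "finite V"
    and indep: "indep_vars (\<lambda>_. borel) T (complete_edges V)"
    and exponential: "e \<in> complete_edges V \<Longrightarrow> distributed M lborel (T e) (exponential_density 1)"
begin

lemma finite_edges: "F \<subseteq> complete_edges V \<Longrightarrow> finite F"
  using finite_complete_edges[OF finite_vertices] finite_subset by blast

lemma weight_measurable: "e \<in> complete_edges V \<Longrightarrow> T e \<in> borel_measurable M"
  using distributed_measurable[OF exponential] by simp

lemma sum_weights_measurable:
  "F \<subseteq> complete_edges V \<Longrightarrow> (\<lambda>\<omega>. \<Sum>e\<in>F. T e \<omega>) \<in> borel_measurable M"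
  by (intro borel_measurable_sum weight_measurable) auto

lemma steiner_weight_measurable:
  assumes "A \<subseteq> V"
  shows "(\<lambda>\<omega>. steiner_weight A (\<lambda>e. T e \<omega>) S) \<in> borel_measurable M"
  using assms complete_edges_mono[OF assms] finite_subset[OF assms finite_vertices]
  by (intro borel_measurable_steiner_weight weight_measurable) auto

lemma AE_weights_nonneg: "AE \<omega> in M. \<forall>e\<in>complete_edges V. 0 \<le> T e \<omega>"
proof (rule AE_finite_allI[OF finite_complete_edges[OF finite_vertices]])
  fix e assume e: "e \<in> complete_edges V"
  note [measurable] = weight_measurable[OF e]
  have "\<P>(\<omega> in M. 0 < T e \<omega>) = 1"
    using exponential_distributedD_gt[OF exponential[OF e], of 0] by simp
  then have "AE \<omega> in M. 0 < T e \<omega>" by (subst (asm) prob_Collect_eq_1) auto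
  then show "AE \<omega> in M. 0 \<le> T e \<omega>" by eventually_elim simp
qed

text \<open>The case \<open>\<mu> = 0\<close> is the tail and \<open>b = 0\<close> the Laplace
  transform of an exponential weight, so one formula serves edges that are required to be heavy,
  edges of the tree, and edges that are both.\<close>

lemma nn_integral_truncated_exp:
  assumes "e \<in> complete_edges V" "b \<ge> 0" "\<mu> \<ge> 0"
  shows "(\<integral>\<^sup>+\<omega>. ennreal (exp (- \<mu> * T e \<omega>)) * indicator {b..} (T e \<omega>) \<partial>M)
    = ennreal (exp (- (1 + \<mu>) * b) / (1 + \<mu>))"
proof -
  have "(\<integral>\<^sup>+\<omega>. ennreal (exp (- \<mu> * T e \<omega>)) * indicator {b..} (T e \<omega>) \<partial>M)
      = (\<integral>\<^sup>+x. ennreal (exponential_density 1 x) * (ennreal (exp (- \<mu> * x)) * indicator {b..} x) \<partial>lborel)"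
    by (rule distributed_nn_integral[OF exponential[OF assms(1)], symmetric]) measurable
  also have "\<dots> = (\<integral>\<^sup>+x. ennreal (exp (- (1 + \<mu>) * x)) * indicator {b..} x \<partial>lborel)"
    using assms(2) by (intro nn_integral_cong)
      (auto simp: exponential_density_def indicator_def ennreal_mult[symmetric] exp_add[symmetric] algebra_simps)
  also have "\<dots> = ennreal (0 - (- exp (- (1 + \<mu>) * b) / (1 + \<mu>)))"
  proof (rule nn_integral_FTC_atLeast)
    show "DERIV (\<lambda>x. - exp (- (1 + \<mu>) * x) / (1 + \<mu>)) x :> exp (- (1 + \<mu>) * x)" for x
    proof -
      have "((\<lambda>x. - exp (- \<nu> * x) / \<nu>) has_real_derivative exp (- \<nu> * x)) (at x)" if "\<nu> > 0" for \<nu> x :: real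
        using that by (auto intro!: derivative_eq_intros)
      from this[of "1 + \<mu>"] assms(3) show ?thesis by simp
    qed
    have "((\<lambda>x. exp (- (1 + \<mu>) * x)) \<longlongrightarrow> 0) at_top"
      using assms(3) by (intro filterlim_compose[OF exp_at_bot])
        (auto intro!: filterlim_tendsto_neg_mult_at_bot[OF tendsto_const] filterlim_ident)
    then have "((\<lambda>x. - exp (- (1 + \<mu>) * x) / (1 + \<mu>)) \<longlongrightarrow> - 0 / (1 + \<mu>)) at_top"
      using assms(3) by (intro tendsto_intros) auto
    then show "((\<lambda>x. - exp (- (1 + \<mu>) * x) / (1 + \<mu>)) \<longlongrightarrow> 0) at_top" by simp
  qed auto
  finally show ?thesis by simp
qed

lemma nn_integral_prod_truncated_exp:
  assumes E: "E \<subseteq> complete_edges V" and b: "\<And>e. e \<in> E \<Longrightarrow> b e \<ge> 0" and \<mu>: "\<And>e. e \<in> E \<Longrightarrow> \<mu> e \<ge> 0"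
  shows "(\<integral>\<^sup>+\<omega>. (\<Prod>e\<in>E. ennreal (exp (- \<mu> e * T e \<omega>)) * indicator {b e..} (T e \<omega>)) \<partial>M)
    = ennreal (\<Prod>e\<in>E. exp (- (1 + \<mu> e) * b e) / (1 + \<mu> e))"
proof -
  have "indep_vars (\<lambda>_. borel) (\<lambda>e \<omega>. ennreal (exp (- \<mu> e * T e \<omega>)) * indicator {b e..} (T e \<omega>)) E"
    by (rule indep_vars_compose2[OF indep_vars_subset[OF indep E]]) measurable
  then have "(\<integral>\<^sup>+\<omega>. (\<Prod>e\<in>E. ennreal (exp (- \<mu> e * T e \<omega>)) * indicator {b e..} (T e \<omega>)) \<partial>M)
    = (\<Prod>e\<in>E. \<integral>\<^sup>+\<omega>. ennreal (exp (- \<mu> e * T e \<omega>)) * indicator {b e..} (T e \<omega>) \<partial>M)"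
    by (intro indep_vars_nn_integral finite_edges E) auto
  also have "\<dots> = (\<Prod>e\<in>E. ennreal (exp (- (1 + \<mu> e) * b e) / (1 + \<mu> e)))"
    using assms by (intro prod.cong refl nn_integral_truncated_exp) auto
  also have "\<dots> = ennreal (\<Prod>e\<in>E. exp (- (1 + \<mu> e) * b e) / (1 + \<mu> e))"
    using \<mu> by (intro prod_ennreal divide_nonneg_nonneg) (auto intro: add_nonneg_nonneg)
  finally show ?thesis .
qed

definition heavy :: "'v set set \<Rightarrow> real \<Rightarrow> 'a set" where
  "heavy K a = {\<omega> \<in> space M. \<forall>e\<in>K. a \<le> T e \<omega>}"

lemma heavy_measurable: "K \<subseteq> complete_edges V \<Longrightarrow> heavy K a \<in> events"
proof -
  assume K: "K \<subseteq> complete_edges V"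
  have "heavy K a = space M \<inter> (\<Inter>e\<in>K. {\<omega> \<in> space M. a \<le> T e \<omega>})" by (auto simp: heavy_def)
  also have "\<dots> \<in> events"
  proof (cases "K = {}")
    case False
    have "{\<omega> \<in> space M. a \<le> T e \<omega>} \<in> events" if "e \<in> K" for e
    proof -
      have [measurable]: "T e \<in> borel_measurable M" using that K weight_measurable by auto
      show ?thesis by measurable
    qed
    then show ?thesis using False finite_edges[OF K] by (intro sets.Int sets.top sets.finite_INT) auto
  qed simp
  finally show ?thesis .
qed

lemma prob_heavy:
  assumes K: "K \<subseteq> complete_edges V" and a: "a \<ge> 0"
  shows "prob (heavy K a) = exp (- a * card K)"
proof -
  have finK: "finite K" by (rule finite_edges[OF K])
  have "emeasure M (heavy K a) = (\<integral>\<^sup>+\<omega>. indicator (heavy K a) \<omega> \<partial>M)"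
    by (simp add: heavy_measurable K)
  also have "\<dots> = (\<integral>\<^sup>+\<omega>. (\<Prod>e\<in>K. ennreal (exp (- 0 * T e \<omega>)) * indicator {a..} (T e \<omega>)) \<partial>M)"
  proof (rule nn_integral_cong)
    fix \<omega> assume "\<omega> \<in> space M"
    then show "indicator (heavy K a) \<omega> = (\<Prod>e\<in>K. ennreal (exp (- 0 * T e \<omega>)) * indicator {a..} (T e \<omega>))"
      using finK by (auto simp: heavy_def indicator_def prod_zero_iff intro!: prod.neutral[symmetric])
  qed
  also have "\<dots> = ennreal (\<Prod>e\<in>K. exp (- (1 + 0) * a) / (1 + 0))"
    using a by (intro nn_integral_prod_truncated_exp[OF K]) auto
  also have "(\<Prod>e\<in>K. exp (- (1 + 0) * a) / (1 + 0)) = exp (- a * card K)"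
    by (simp add: exp_of_nat_mult[symmetric] mult.commute)
  finally show ?thesis by (simp add: emeasure_eq_measure)
qed

text \<open>Exponential Markov inequality on the event \<open>heavy K a\<close>, whose probability
  is the factor exp(- a card K). Given this event, an edge of \<open>K\<close> is \<open>a\<close>
  plus a fresh exponential, so every edge of \<open>K \<inter> F\<close> uses up \<open>a\<close> of
  the budget \<open>c\<close> for certain.\<close>

lemma chernoff:
  assumes K: "K \<subseteq> complete_edges V" and F: "F \<subseteq> complete_edges V" and a: "a \<ge> 0" and \<theta>: "\<theta> \<ge> 0"
  shows "prob {\<omega> \<in> heavy K a. (\<Sum>e\<in>F. T e \<omega>) \<le> c}
    \<le> exp (\<theta> * (c - a * card (K \<inter> F))) * exp (- a * card K) / (1 + \<theta>) ^ card F"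
proof -
  \<comment> \<open>A single product over all edges treats the four cases of membership in
    \<open>K\<close> and \<open>F\<close> alike. The truncation at 0 off \<open>K\<close> is
    harmless because weights are almost surely nonnegative.\<close>
  define b where "b e = (if e \<in> K then a else 0)" for e
  define \<mu> where "\<mu> e = (if e \<in> F then \<theta> else 0)" for e
  let ?E = "complete_edges V" and ?A = "{\<omega> \<in> heavy K a. (\<Sum>e\<in>F. T e \<omega>) \<le> c}"
  have fin: "finite ?E" by (rule finite_edges) simp
  have [measurable]: "heavy K a \<in> events" "(\<lambda>\<omega>. \<Sum>e\<in>F. T e \<omega>) \<in> borel_measurable M"
    using heavy_measurable[OF K] sum_weights_measurable[OF F] by auto
  have A: "?A \<in> events"
  proof -
    have "?A = heavy K a \<inter> {\<omega> \<in> space M. (\<Sum>e\<in>F. T e \<omega>) \<le> c}" by (auto simp: heavy_def)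
    then show ?thesis by simp
  qed
  have "emeasure M ?A = (\<integral>\<^sup>+\<omega>. indicator ?A \<omega> \<partial>M)" using A by simp
  also have "\<dots> \<le> (\<integral>\<^sup>+\<omega>. ennreal (exp (\<theta> * c)) *
      (\<Prod>e\<in>?E. ennreal (exp (- \<mu> e * T e \<omega>)) * indicator {b e..} (T e \<omega>)) \<partial>M)"
  proof (rule nn_integral_mono_AE)
    from AE_weights_nonneg show "AE \<omega> in M. indicator ?A \<omega> \<le> ennreal (exp (\<theta> * c)) *
      (\<Prod>e\<in>?E. ennreal (exp (- \<mu> e * T e \<omega>)) * indicator {b e..} (T e \<omega>))"
    proof eventually_elim
      case (elim \<omega>)
      show ?case
      proof (cases "\<omega> \<in> ?A")
        case True
        then have "(\<Prod>e\<in>?E. ennreal (exp (- \<mu> e * T e \<omega>)) * indicator {b e..} (T e \<omega>))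
            = (\<Prod>e\<in>?E. ennreal (exp (- \<mu> e * T e \<omega>)))"
          using elim by (intro prod.cong) (auto simp: b_def heavy_def indicator_def)
        also have "\<dots> = ennreal (exp (\<Sum>e\<in>?E. - \<mu> e * T e \<omega>))"
          by (simp add: prod_ennreal exp_sum[OF fin])
        also have "(\<Sum>e\<in>?E. - \<mu> e * T e \<omega>) = (\<Sum>e\<in>F. - \<theta> * T e \<omega>)"
          using F fin by (intro sum.mono_neutral_cong_right) (auto simp: \<mu>_def)
        also have "\<dots> = - \<theta> * (\<Sum>e\<in>F. T e \<omega>)" by (simp add: sum_distrib_left)
        finally have eq: "(\<Prod>e\<in>?E. ennreal (exp (- \<mu> e * T e \<omega>)) * indicator {b e..} (T e \<omega>))
            = ennreal (exp (- \<theta> * (\<Sum>e\<in>F. T e \<omega>)))" .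
        have "1 \<le> exp (\<theta> * (c - (\<Sum>e\<in>F. T e \<omega>)))" using True \<theta> by simp
        then show ?thesis unfolding eq using True
          by (simp add: ennreal_mult[symmetric] exp_add[symmetric] algebra_simps)
      qed simp
    qed
  qed
  also have "\<dots> = ennreal (exp (\<theta> * c)) * ennreal (\<Prod>e\<in>?E. exp (- (1 + \<mu> e) * b e) / (1 + \<mu> e))"
  proof (subst nn_integral_cmult)
    show "(\<lambda>\<omega>. \<Prod>e\<in>?E. ennreal (exp (- \<mu> e * T e \<omega>)) * indicator {b e..} (T e \<omega>)) \<in> borel_measurable M"
      by (intro borel_measurable_prod_ennreal borel_measurable_times_ennreal measurable_compose[OF weight_measurable]) auto
    show "ennreal (exp (\<theta> * c)) * (\<integral>\<^sup>+\<omega>. (\<Prod>e\<in>?E. ennreal (exp (- \<mu> e * T e \<omega>)) * indicator {b e..} (T e \<omega>)) \<partial>M)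
      = ennreal (exp (\<theta> * c)) * ennreal (\<Prod>e\<in>?E. exp (- (1 + \<mu> e) * b e) / (1 + \<mu> e))"
      using a \<theta> by (subst nn_integral_prod_truncated_exp) (auto simp: b_def \<mu>_def)
  qed
  also have "(\<Prod>e\<in>?E. exp (- (1 + \<mu> e) * b e) / (1 + \<mu> e)) =
    (\<Prod>e\<in>?E. exp (- (1 + \<mu> e) * b e)) / (\<Prod>e\<in>?E. 1 + \<mu> e)" by (rule prod_dividef)
  also have "(\<Prod>e\<in>?E. 1 + \<mu> e) = (\<Prod>e\<in>F. 1 + \<theta>)"
    using F fin by (intro prod.mono_neutral_cong_right) (auto simp: \<mu>_def)
  also have "(\<Prod>e\<in>?E. exp (- (1 + \<mu> e) * b e)) = exp (\<Sum>e\<in>?E. - (1 + \<mu> e) * b e)"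
    by (simp add: exp_sum[OF fin])
  also have "(\<Sum>e\<in>?E. - (1 + \<mu> e) * b e) = - (\<Sum>e\<in>?E. b e) - (\<Sum>e\<in>?E. \<mu> e * b e)"
    by (simp add: algebra_simps sum.distrib sum_negf sum_subtractf)
  also have "(\<Sum>e\<in>?E. b e) = (\<Sum>e\<in>K. a)"
    using K fin by (intro sum.mono_neutral_cong_right) (auto simp: b_def)
  also have "(\<Sum>e\<in>?E. \<mu> e * b e) = (\<Sum>e\<in>K \<inter> F. \<theta> * a)"
    using K fin by (intro sum.mono_neutral_cong_right) (auto simp: b_def \<mu>_def)
  finally have "ennreal (prob ?A) \<le> ennreal (exp (\<theta> * c) *
      (exp (- (\<Sum>e\<in>K. a) - (\<Sum>e\<in>K \<inter> F. \<theta> * a)) / (\<Prod>e\<in>F. 1 + \<theta>)))"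
    using \<theta> by (subst ennreal_mult) (simp_all add: emeasure_eq_measure)
  then have "prob ?A \<le> exp (\<theta> * c) *
      (exp (- (\<Sum>e\<in>K. a) - (\<Sum>e\<in>K \<inter> F. \<theta> * a)) / (\<Prod>e\<in>F. 1 + \<theta>))"
    using \<theta> by (subst (asm) ennreal_le_iff) auto
  also have "\<dots> = exp (\<theta> * (c - a * card (K \<inter> F))) * exp (- a * card K) / (1 + \<theta>) ^ card F"
    by (simp add: exp_add[symmetric] algebra_simps)
  finally show ?thesis .
qed

section \<open>First moment bound for trees through prescribed terminals\<close>

definition incident :: "'v set \<Rightarrow> 'v set set" where
  "incident Q = {e \<in> complete_edges V. e \<inter> Q \<noteq> {}}"

lemma incident_subset: "incident Q \<subseteq> complete_edges V"
  by (auto simp: incident_def)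

lemma card_incident_ge:
  assumes "Q \<subseteq> V"
  shows "card (incident Q) \<ge> card Q * (card V - card Q)"
proof -
  have "card Q * (card V - card Q) = card (Q \<times> (V - Q))"
    using assms finite_vertices by (simp add: card_cartesian_product card_Diff_subset finite_subset)
  also have "\<dots> = card ((\<lambda>(u, v). {u, v}) ` (Q \<times> (V - Q)))"
    by (rule card_image[symmetric]) (auto simp: inj_on_def doubleton_eq_iff)
  also have "\<dots> \<le> card (incident Q)"
    using assms by (intro card_mono finite_edges incident_subset)
      (auto simp: incident_def pair_in_complete_edges)
  finally show ?thesis .
qed

lemma card_incident_singleton:
  assumes "v \<in> V"
  shows "card (incident {v}) = card V - 1"
proof -
  have "incident {v} = (\<lambda>u. {u, v}) ` (V - {v})"
    using assms by (auto simp: incident_def pair_in_complete_edges elim!: complete_edgesE)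
  moreover have "inj_on (\<lambda>u. {u, v}) (V - {v})" by (auto simp: inj_on_def doubleton_eq_iff)
  ultimately show ?thesis using assms finite_vertices by (simp add: card_image)
qed

text \<open>Union bound over branching walks with \<open>card R\<close> jumps. Each walk has at
  least \<open>card Q\<close> edges meeting \<open>Q\<close>, so the allowance
  \<open>a * card Q\<close> cancels in \<open>chernoff\<close> and only \<open>t\<close> remains.
  The exponent 4 is 2 * (jumps + prescribed vertices), both equal to \<open>card R\<close>.\<close>

lemma prob_heavy_light:
  fixes a t \<theta> :: real
  assumes r: "r \<in> V" and R: "R \<subseteq> V - {r}" and Q: "Q \<subseteq> R" and a: "a \<ge> 0" and \<theta>: "\<theta> \<ge> 0"
  shows "prob {\<omega> \<in> heavy (incident Q) a. steiner_weight V (\<lambda>e. T e \<omega>) (insert r R) \<le> t + a * card Q}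
    \<le> exp (\<theta> * t) / real (card V) ^ card R *
       (\<Sum>e<card V. (card V / (1 + \<theta>)) ^ e * real (e + 1) ^ (4 * card R)) * exp (- a * card (incident Q))"
    (is "prob ?A \<le> _")
proof -
  define W where "W e = branching_walks V r (card R) e R" for e
  define c where "c = t + a * card Q"
  define n where "n = card V"
  define D where "D = (\<lambda>(U :: 'v set, F, x :: 'v). {\<omega> \<in> heavy (incident Q) a. (\<Sum>e\<in>F. T e \<omega>) \<le> c})"
  \<comment> \<open>A walk inside \<open>V\<close> has one edge fewer than vertices, hence fewer
    than \<open>n\<close> edges.\<close>
  let ?S = "SIGMA e:{..<n}. W e"
  have n: "n > 0" using r finite_vertices by (auto simp: n_def card_gt_0_iff)
  have finW: "finite (W e)" for e by (simp add: W_def finite_branching_walks finite_vertices)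
  have finS: "finite ?S" by (intro finite_SigmaI finW) auto
  have Wprops: "F \<subseteq> complete_edges V" "card F = e" "card Q \<le> card (incident Q \<inter> F)"
    if "(U, F, x) \<in> W e" for e U F x
  proof -
    have *: "branching_walk r (card R) U F x" "U \<subseteq> V" "card F = e" "R \<subseteq> U"
      using that by (auto simp: W_def branching_walks_def)
    note b = branching_walk_basic[OF *(1)]
    show F: "F \<subseteq> complete_edges V" using b(5) complete_edges_mono[OF *(2)] by auto
    show "card F = e" by fact
    have "card Q \<le> card {e \<in> F. e \<inter> Q \<noteq> {}}"
      using Q R *(4) by (intro branching_walk_touching[OF *(1)]) auto
    also have "{e \<in> F. e \<inter> Q \<noteq> {}} = incident Q \<inter> F" using F by (auto simp: incident_def)
    finally show "card Q \<le> card (incident Q \<inter> F)" .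
  qed
  have Dmeas: "D w \<in> events" if "w \<in> W e" for w e
  proof -
    obtain U F x where w: "w = (U, F, x)" by (cases w)
    have [measurable]: "heavy (incident Q) a \<in> events" "(\<lambda>\<omega>. \<Sum>e\<in>F. T e \<omega>) \<in> borel_measurable M"
      using heavy_measurable[OF incident_subset] sum_weights_measurable[OF Wprops(1)] that w by auto
    have "D w = heavy (incident Q) a \<inter> {\<omega> \<in> space M. (\<Sum>e\<in>F. T e \<omega>) \<le> c}"
      by (auto simp: D_def w heavy_def)
    then show ?thesis by simp
  qed
  have "prob ?A \<le> prob (\<Union>(e, w)\<in>?S. D w)"
  proof (rule finite_measure_mono_AE)
    show "(\<Union>(e, w)\<in>?S. D w) \<in> events" using Dmeas finS by (intro sets.finite_UN) auto
    from AE_weights_nonneg show "AE \<omega> in M. \<omega> \<in> ?A \<longrightarrow> \<omega> \<in> (\<Union>(e, w)\<in>?S. D w)"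
    proof (eventually_elim, intro impI)
      fix \<omega> assume pos: "\<forall>e\<in>complete_edges V. 0 \<le> T e \<omega>" and A: "\<omega> \<in> ?A"
      obtain U0 F0 where UF0: "(U0, F0) \<in> connecting_subgraphs V (insert r R)"
        "steiner_weight V (\<lambda>e. T e \<omega>) (insert r R) = (\<Sum>e\<in>F0. T e \<omega>)"
        using steiner_weight_attained[OF finite_vertices, of "insert r R"] r R by blast
      have conn: "connected_graph U0 F0" "r \<in> U0" "R \<subseteq> U0" "U0 \<subseteq> V" "F0 \<subseteq> complete_edges U0"
        using UF0(1) by (auto simp: connecting_subgraphs_def)
      have F0: "F0 \<subseteq> complete_edges V" using connecting_subgraphs_edges[OF UF0(1)] .
      have "finite R" using R finite_vertices finite_subset by blast
      from branching_walk_exists[OF conn(1,2) this conn(3)] obtain U F x where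
        bw: "branching_walk r (card R) U F x" "R \<subseteq> U" "F \<subseteq> F0" by blast
      note b = branching_walk_basic[OF bw(1)]
      \<comment> \<open>Every visited vertex except \<open>r\<close> lies on an edge of
        \<open>F\<close>, and \<open>F\<close> consists of edges of the optimal subgraph.\<close>
      have "U \<subseteq> V"
      proof (cases "F = {}")
        case True
        then have "card U = 1" using b(6) by simp
        then show ?thesis using b(2) r by (auto simp: card_1_singleton_iff)
      next
        case False
        show ?thesis
        proof
          fix u assume u: "u \<in> U"
          show "u \<in> V"
          proof (cases "u = r")
            case False
            then have "1 \<le> card {e \<in> F. e \<inter> {u} \<noteq> {}}"
              using branching_walk_touching[OF bw(1), of "{u}"] u by simp
            then have "{e \<in> F. e \<inter> {u} \<noteq> {}} \<noteq> {}" by (metis card.empty not_one_le_zero)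
            then obtain e where "e \<in> F" "u \<in> e" by auto
            then show ?thesis using bw(3) F0 by (auto simp: complete_edges_def)
          qed (use r in simp)
        qed
      qed
      moreover have "card F < n"
        using b(6) card_mono[OF finite_vertices \<open>U \<subseteq> V\<close>] by (simp add: n_def)
      ultimately have "(card F, U, F, x) \<in> ?S"
        using bw by (auto simp: W_def branching_walks_def)
      moreover have "\<omega> \<in> D (U, F, x)"
      proof -
        have "(\<Sum>e\<in>F. T e \<omega>) \<le> (\<Sum>e\<in>F0. T e \<omega>)"
          using bw(3) F0 pos finite_edges[OF F0] by (intro sum_mono2) auto
        then show ?thesis using A UF0(2) by (auto simp: D_def c_def)
      qed
      ultimately show "\<omega> \<in> (\<Union>(e, w)\<in>?S. D w)" by blast
    qed
  qed
  also have "\<dots> \<le> (\<Sum>(e, w)\<in>?S. prob (D w))"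
  proof -
    have "(\<lambda>(e, w). D w) ` ?S \<subseteq> events" using Dmeas by auto
    from finite_measure_subadditive_finite[OF finS this] show ?thesis by (simp add: case_prod_beta)
  qed
  also have "\<dots> \<le> (\<Sum>(e, w)\<in>?S. exp (\<theta> * t) * exp (- a * card (incident Q)) / (1 + \<theta>) ^ e)"
  proof (rule sum_mono, clarify)
    fix e U F x assume W: "(U, F, x) \<in> W e"
    have "prob (D (U, F, x)) \<le> exp (\<theta> * (c - a * card (incident Q \<inter> F))) * exp (- a * card (incident Q)) / (1 + \<theta>) ^ card F"
      unfolding D_def using chernoff[OF incident_subset Wprops(1)[OF W] a \<theta>] by simp
    also have "\<dots> \<le> exp (\<theta> * t) * exp (- a * card (incident Q)) / (1 + \<theta>) ^ card F"
    proof -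
      have "a * real (card Q) \<le> a * real (card (incident Q \<inter> F))"
        using a Wprops(3)[OF W] by (intro mult_left_mono) auto
      then have "\<theta> * (c - a * card (incident Q \<inter> F)) \<le> \<theta> * t"
        using \<theta> by (intro mult_left_mono) (auto simp: c_def)
      then show ?thesis using \<theta> by (intro divide_right_mono mult_right_mono) auto
    qed
    finally show "prob (D (U, F, x)) \<le> exp (\<theta> * t) * exp (- a * card (incident Q)) / (1 + \<theta>) ^ e"
      by (simp add: Wprops(2)[OF W])
  qed
  also have "\<dots> = (\<Sum>e<n. card (W e) * (exp (\<theta> * t) * exp (- a * card (incident Q)) / (1 + \<theta>) ^ e))"
    using finW by (subst sum.Sigma[symmetric]) auto
  also have "\<dots> \<le> (\<Sum>e<n. (n ^ e * (e + 1) ^ (4 * card R) / n ^ card R) *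
      (exp (\<theta> * t) * exp (- a * card (incident Q)) / (1 + \<theta>) ^ e))"
  proof (intro sum_mono mult_right_mono)
    fix e
    have "n ^ card R * card (W e) \<le> n ^ e * (e + 1) ^ (4 * card R)"
      using card_branching_walks[OF finite_vertices R, of "card R" e] by (simp add: W_def n_def)
    then have "real (n ^ card R * card (W e)) \<le> real (n ^ e * (e + 1) ^ (4 * card R))"
      by (rule of_nat_mono)
    then show "real (card (W e)) \<le> real (n ^ e * (e + 1) ^ (4 * card R)) / real (n ^ card R)"
      using n by (simp add: field_simps)
  qed (use \<theta> in auto)
  also have "\<dots> = exp (\<theta> * t) / real n ^ card R *
       (\<Sum>e<n. (n / (1 + \<theta>)) ^ e * real (e + 1) ^ (4 * card R)) * exp (- a * card (incident Q))"
    unfolding sum_distrib_left sum_distrib_right by (intro sum.cong) (auto simp: power_divide)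
  finally show ?thesis by (simp add: n_def)
qed

section \<open>The special vertices: second moment and comparison of counts\<close>

definition isolated :: "'v set \<Rightarrow> real \<Rightarrow> 'a \<Rightarrow> 'v set" where
  "isolated W a \<omega> = {v \<in> W. \<omega> \<in> heavy (incident {v}) a}"

lemma heavy_incident_iff:
  assumes "Q \<subseteq> W" "\<omega> \<in> space M"
  shows "\<omega> \<in> heavy (incident Q) a \<longleftrightarrow> Q \<subseteq> isolated W a \<omega>"
  using assms by (fastforce simp: heavy_def isolated_def incident_def)

lemma card_isolated_eq:
  "finite W \<Longrightarrow> real (card (isolated W a \<omega>)) = (\<Sum>v\<in>W. indicator (heavy (incident {v}) a) \<omega>)"
  by (simp add: isolated_def indicator_def sum.If_cases Int_def)

text \<open>Chebyshev's inequality, where \<open>m\<close> is the expected number of special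
  vertices in \<open>W\<close>. Two vertices interact only through the edge joining them; this is
  the source of the term in \<open>exp (2 * a)\<close>, which vanishes as \<open>a\<close> tends to
  0.\<close>

lemma prob_few_isolated:
  fixes a :: real
  assumes W: "W \<subseteq> V" and a: "a \<ge> 0" and ne: "W \<noteq> {}"
  defines "m \<equiv> card W * exp (- a * (real (card V) - 1))"
  shows "prob {\<omega> \<in> space M. card (isolated W a \<omega>) < m / 2} \<le> 4 / m + 4 * (exp (2 * a) - 1)"
proof -
  define p where "p = exp (- a * (real (card V) - 1))"
  define Y where "Y \<omega> = (\<Sum>v\<in>W. indicator (heavy (incident {v}) a) \<omega> :: real)" for \<omega>
  have finW: "finite W" using W finite_vertices finite_subset by blast
  have V: "card V \<ge> 1" using ne W finite_vertices by (metis One_nat_def Suc_leI card_gt_0_iff subset_empty)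
  have m: "m > 0" "m = card W * p" using ne finW by (auto simp: m_def p_def card_gt_0_iff)
  have hm[measurable]: "heavy (incident Q) a \<in> events" for Q by (intro heavy_measurable incident_subset)
  have [measurable]: "Y \<in> borel_measurable M" unfolding Y_def[abs_def] by measurable
  have Y_bound: "norm (Y \<omega>) \<le> card W" for \<omega>
  proof -
    have "Y \<omega> \<le> (\<Sum>v\<in>W. 1)" unfolding Y_def by (intro sum_mono) (auto simp: indicator_def)
    moreover have "Y \<omega> \<ge> 0" unfolding Y_def by (intro sum_nonneg) auto
    ultimately show ?thesis by simp
  qed
  have intY: "integrable M Y" by (rule integrable_const_bound[of _ "card W"]) (use Y_bound in auto)
  have intY2: "integrable M (\<lambda>\<omega>. (Y \<omega>)\<^sup>2)"
  proof (rule integrable_const_bound[of _ "(card W)\<^sup>2"])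
    show "AE \<omega> in M. norm ((Y \<omega>)\<^sup>2) \<le> (card W)\<^sup>2"
      using power_mono[OF Y_bound, where n = 2] by (auto simp: power_abs[symmetric])
  qed measurable
  have p1: "prob (heavy (incident {v}) a) = p" if "v \<in> W" for v
    using that W V by (subst prob_heavy[OF incident_subset a])
      (auto simp: p_def card_incident_singleton of_nat_diff)
  have EY: "expectation Y = m"
    unfolding Y_def by (subst Bochner_Integration.integral_sum)
      (auto simp: p1 m emeasure_eq_measure intro!: integrable_real_indicator)
  have p2: "prob (heavy (incident {u}) a \<inter> heavy (incident {v}) a) \<le> p\<^sup>2 * exp (2 * a)"
    if "u \<in> W" "v \<in> W" "u \<noteq> v" for u v
  proof -
    have "heavy (incident {u}) a \<inter> heavy (incident {v}) a = heavy (incident {u, v}) a"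
      by (auto simp: heavy_def incident_def)
    then have "prob (heavy (incident {u}) a \<inter> heavy (incident {v}) a) = exp (- a * card (incident {u, v}))"
      by (simp add: prob_heavy[OF incident_subset a])
    also have "\<dots> \<le> exp (- a * (2 * (real (card V) - 2)))"
    proof -
      \<comment> \<open>The joining edge is dropped from the count, hence \<open>exp (2 * a)\<close>
        below where \<open>exp a\<close> would be exact.\<close>
      have "2 * (card V - 2) \<le> card (incident {u, v})"
        using card_incident_ge[of "{u, v}"] subsetD[OF W] that by simp
      then have "a * (2 * (real (card V) - 2)) \<le> a * card (incident {u, v})"
      proof (intro mult_left_mono a)
        have "real (card V) - 2 \<le> real (card V - 2)" by (cases "card V \<ge> 2") (auto simp: of_nat_diff)
        then show "2 * (real (card V) - 2) \<le> card (incident {u, v})"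
          using of_nat_mono[OF \<open>2 * (card V - 2) \<le> card (incident {u, v})\<close>, where 'a = real] by simp
      qed
      then show ?thesis by simp
    qed
    also have "\<dots> = p\<^sup>2 * exp (2 * a)"
      by (simp add: p_def exp_double[symmetric] exp_add[symmetric] algebra_simps)
    finally show ?thesis .
  qed
  have "expectation (\<lambda>\<omega>. (Y \<omega>)\<^sup>2) = expectation (\<lambda>\<omega>. \<Sum>u\<in>W. \<Sum>v\<in>W. indicator (heavy (incident {u}) a \<inter> heavy (incident {v}) a) \<omega>)"
    by (intro Bochner_Integration.integral_cong refl)
      (simp add: Y_def power2_eq_square sum_product indicator_inter_arith)
  also have "\<dots> = (\<Sum>u\<in>W. \<Sum>v\<in>W. prob (heavy (incident {u}) a \<inter> heavy (incident {v}) a))"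
  proof -
    have int: "integrable M (indicat_real (heavy (incident {u}) a \<inter> heavy (incident {v}) a))" for u v
      by (rule integrable_real_indicator) (auto simp: emeasure_eq_measure)
    show ?thesis by (simp add: Bochner_Integration.integral_sum int)
  qed
  also have "\<dots> \<le> (\<Sum>u\<in>W. \<Sum>v\<in>W. (if u = v then p else 0) + p\<^sup>2 * exp (2 * a))"
    using p1 p2 by (intro sum_mono) auto
  also have "\<dots> = m + m\<^sup>2 * exp (2 * a)"
    using finW by (simp add: sum.distrib m power2_eq_square algebra_simps)
  finally have EY2: "expectation (\<lambda>\<omega>. (Y \<omega>)\<^sup>2) \<le> m + m\<^sup>2 * exp (2 * a)" .
  have "prob {\<omega> \<in> space M. card (isolated W a \<omega>) < m / 2} \<le> prob {\<omega> \<in> space M. m / 2 \<le> \<bar>Y \<omega> - expectation Y\<bar>}"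
  proof (rule finite_measure_mono)
    have "m / 2 \<le> \<bar>y - m\<bar>" if "y < m / 2" for y using that m(1) by linarith
    then show "{\<omega> \<in> space M. card (isolated W a \<omega>) < m / 2} \<subseteq> {\<omega> \<in> space M. m / 2 \<le> \<bar>Y \<omega> - expectation Y\<bar>}"
      unfolding EY card_isolated_eq[OF finW] Y_def[symmetric] by blast
  qed measurable
  also have "\<dots> \<le> variance Y / (m / 2)\<^sup>2"
    using m by (intro Chebyshev_inequality intY2) auto
  also have "\<dots> \<le> (m + m\<^sup>2 * exp (2 * a) - m\<^sup>2) / (m / 2)\<^sup>2"
    using EY2 variance_eq[OF intY intY2] by (intro divide_right_mono) (auto simp: EY)
  also have "\<dots> = 4 / m + 4 * (exp (2 * a) - 1)"
    using m(1) by (simp add: field_simps power2_eq_square)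
  finally show ?thesis .
qed

text \<open>Unless there are fewer than \<open>m / 2\<close> special vertices, at least
  \<open>(m / (2 * l)) ^ l\<close> sets \<open>Q\<close> are heavy, and on the event all of them are
  cheap as well. By \<open>bad\<close> the expected number of heavy and cheap sets is at most
  \<open>\<delta>\<close> times m^l exp(a l^2), and Markov's inequality compares the two; the powers
  of \<open>m\<close> cancel.\<close>

lemma prob_all_light:
  fixes a c :: real
  assumes r: "r \<in> V" and B: "B \<subseteq> V - {r}" and a: "a \<ge> 0" and l: "l > 0" "l \<le> card V"
  defines "W \<equiv> V - insert r B"
  defines "m \<equiv> card W * exp (- a * (real (card V) - 1))"
  assumes m: "m \<ge> 2 * real l" and \<delta>: "\<delta> \<ge> 0"
    and bad: "\<And>Q. Q \<subseteq> W \<Longrightarrow> card Q = l \<Longrightarrow>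
      prob {\<omega> \<in> heavy (incident Q) a. steiner_weight V (\<lambda>e. T e \<omega>) (insert r (B \<union> Q)) \<le> c}
        \<le> \<delta> * exp (- a * card (incident Q))"
  shows "prob {\<omega> \<in> space M. \<forall>Q\<subseteq>W. card Q = l \<longrightarrow> steiner_weight V (\<lambda>e. T e \<omega>) (insert r (B \<union> Q)) \<le> c}
    \<le> 4 / m + 4 * (exp (2 * a) - 1) + \<delta> * (2 * real l) ^ l * exp (a * real l ^ 2)"
    (is "prob ?A \<le> _")
proof -
  define badQ where "badQ Q = {\<omega> \<in> heavy (incident Q) a. steiner_weight V (\<lambda>e. T e \<omega>) (insert r (B \<union> Q)) \<le> c}" for Q
  define QQ where "QQ = {Q. Q \<subseteq> W \<and> card Q = l}"
  define N where "N \<omega> = (\<Sum>Q\<in>QQ. indicator (badQ Q) \<omega> :: real)" for \<omega>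
  \<comment> \<open>Lower bound for the number of \<open>l\<close>-subsets of \<open>m / 2\<close>
    special vertices; \<open>m \<ge> 2 * real l\<close> makes the binomial estimate
    applicable.\<close>
  define b where "b = (m / (2 * l)) ^ l"
  have W: "W \<subseteq> V" and finW: "finite W" using finite_vertices by (auto simp: W_def)
  have finQQ: "finite QQ" using finW by (auto simp: QQ_def)
  have m0: "m > 0" using m l by linarith
  have ne: "W \<noteq> {}" using m0 by (auto simp: m_def)
  have b0: "b > 0" using m0 l by (simp add: b_def)
  have hm[measurable]: "heavy (incident Q) a \<in> events" for Q by (intro heavy_measurable incident_subset)
  have [measurable]: "(\<lambda>\<omega>. steiner_weight V (\<lambda>e. T e \<omega>) S) \<in> borel_measurable M" for S
    by (rule steiner_weight_measurable) simp
  have badQ[measurable]: "badQ Q \<in> events" for Q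
  proof -
    have "badQ Q = heavy (incident Q) a \<inter> {\<omega> \<in> space M. steiner_weight V (\<lambda>e. T e \<omega>) (insert r (B \<union> Q)) \<le> c}"
      by (auto simp: badQ_def heavy_def)
    then show ?thesis by simp
  qed
  have [measurable]: "N \<in> borel_measurable M" unfolding N_def[abs_def] by measurable
  have sub: "?A \<subseteq> {\<omega> \<in> space M. card (isolated W a \<omega>) < m / 2} \<union> {\<omega> \<in> space M. b \<le> N \<omega>}"
  proof
    fix \<omega> assume A: "\<omega> \<in> ?A"
    show "\<omega> \<in> {\<omega> \<in> space M. card (isolated W a \<omega>) < m / 2} \<union> {\<omega> \<in> space M. b \<le> N \<omega>}"
    proof (cases "card (isolated W a \<omega>) < m / 2")
      case False
      let ?I = "isolated W a \<omega>"
      have I: "?I \<subseteq> W" "finite ?I" using finW by (auto simp: isolated_def)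
      have "real l \<le> card ?I" using False m by linarith
      have "b \<le> (card ?I / real l) ^ l"
        unfolding b_def using False m0 l by (intro power_mono) (auto simp: field_simps)
      also have "\<dots> \<le> card ?I choose l"
        using binomial_ge_n_over_k_pow_k[of l "card ?I"] \<open>real l \<le> card ?I\<close> by simp
      also have "\<dots> = card {Q. Q \<subseteq> ?I \<and> card Q = l}" using n_subsets[OF I(2)] by simp
      also have "\<dots> = (\<Sum>Q\<in>{Q. Q \<subseteq> ?I \<and> card Q = l}. 1)" by simp
      also have "\<dots> \<le> (\<Sum>Q\<in>{Q. Q \<subseteq> ?I \<and> card Q = l}. indicator (badQ Q) \<omega>)"
      proof (rule sum_mono)
        fix Q assume Q: "Q \<in> {Q. Q \<subseteq> ?I \<and> card Q = l}"
        then have "\<omega> \<in> heavy (incident Q) a" using A I heavy_incident_iff[of Q W \<omega> a] by auto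
        then show "1 \<le> (indicator (badQ Q) \<omega> :: real)" using A Q I by (auto simp: badQ_def)
      qed
      also have "\<dots> \<le> N \<omega>"
        unfolding N_def using I finQQ by (intro sum_mono2) (auto simp: QQ_def)
      finally show ?thesis using A by simp
    qed (use A in simp)
  qed
  have "prob ?A \<le> prob {\<omega> \<in> space M. card (isolated W a \<omega>) < m / 2} + prob {\<omega> \<in> space M. b \<le> N \<omega>}"
  proof -
    have "(\<lambda>\<omega>. real (card (isolated W a \<omega>))) \<in> borel_measurable M"
      unfolding card_isolated_eq[OF finW] by measurable
    then have few: "{\<omega> \<in> space M. card (isolated W a \<omega>) < m / 2} \<in> events" by simp
    have "prob ?A \<le> prob ({\<omega> \<in> space M. card (isolated W a \<omega>) < m / 2} \<union> {\<omega> \<in> space M. b \<le> N \<omega>})"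
      by (intro finite_measure_mono[OF sub] sets.Un few) measurable
    also have "\<dots> \<le> prob {\<omega> \<in> space M. card (isolated W a \<omega>) < m / 2} + prob {\<omega> \<in> space M. b \<le> N \<omega>}"
      by (intro measure_Un_le few) measurable
    finally show ?thesis .
  qed
  also have "\<dots> \<le> (4 / m + 4 * (exp (2 * a) - 1)) + expectation N / b"
  proof (rule add_mono)
    show "prob {\<omega> \<in> space M. card (isolated W a \<omega>) < m / 2} \<le> 4 / m + 4 * (exp (2 * a) - 1)"
      unfolding m_def by (rule prob_few_isolated[OF W a ne])
    have N0: "0 \<le> N \<omega>" for \<omega> by (simp add: N_def sum_nonneg)
    have "integrable M N" unfolding N_def[abs_def]
      by (intro Bochner_Integration.integrable_sum integrable_real_indicator) (auto simp: emeasure_eq_measure)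
    then show "prob {\<omega> \<in> space M. b \<le> N \<omega>} \<le> expectation N / b"
      using b0 by (intro integral_Markov_inequality_measure[where A = "{}"]) (auto intro!: AE_I2 simp: N0)
  qed
  also have "expectation N / b \<le> \<delta> * (2 * real l) ^ l * exp (a * real l ^ 2)"
  proof -
    have "expectation N = (\<Sum>Q\<in>QQ. prob (badQ Q))"
      unfolding N_def by (subst Bochner_Integration.integral_sum)
        (auto simp: emeasure_eq_measure intro!: integrable_real_indicator)
    also have "\<dots> \<le> (\<Sum>Q\<in>QQ. \<delta> * (exp (- a * (real (card V) - 1)) ^ l * exp (a * real l ^ 2)))"
    proof (rule sum_mono)
      fix Q assume Q: "Q \<in> QQ"
      have "l * (card V - l) \<le> card (incident Q)"
        using card_incident_ge[of Q] Q W by (auto simp: QQ_def)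
      then have "real (l * (card V - l)) \<le> card (incident Q)" by (rule of_nat_mono)
      then have "real l * (real (card V) - real l) \<le> card (incident Q)" using l by (simp add: of_nat_diff)
      then have "a * (real l * (real (card V) - real l)) \<le> a * card (incident Q)"
        using a by (rule mult_left_mono)
      moreover have "a * (l * real l) \<ge> 0" "a * l \<ge> 0" using a by auto
      \<comment> \<open>The bound l (n - l) falls short of l (n - 1) by l (l - 1); rounding up to
        l^2 gives the factor exp(a l^2), which tends to 1 in the application.\<close>
      ultimately have "- a * card (incident Q) \<le> l * (- a * (real (card V) - 1)) + a * real l ^ 2"
        by (simp add: algebra_simps power2_eq_square)
      then have "exp (- a * card (incident Q)) \<le> exp (- a * (real (card V) - 1)) ^ l * exp (a * real l ^ 2)"
        by (simp add: exp_of_nat_mult[symmetric] exp_add[symmetric])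
      with bad[of Q] Q \<delta> show "prob (badQ Q) \<le> \<delta> * (exp (- a * (real (card V) - 1)) ^ l * exp (a * real l ^ 2))"
        unfolding badQ_def QQ_def by (auto intro: order_trans mult_left_mono)
    qed
    also have "\<dots> = (card W choose l) * (\<delta> * (exp (- a * (real (card V) - 1)) ^ l * exp (a * real l ^ 2)))"
      using n_subsets[OF finW, of l] by (simp add: QQ_def)
    also have "\<dots> \<le> card W ^ l * (\<delta> * (exp (- a * (real (card V) - 1)) ^ l * exp (a * real l ^ 2)))"
    proof (rule mult_right_mono)
      show "real (card W choose l) \<le> real (card W ^ l)"
      proof (cases "l \<le> card W")
        case True
        from binomial_le_pow[OF this] show ?thesis by (rule of_nat_mono)
      qed (simp add: binomial_eq_0)
    qed (use \<delta> in auto)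
    also have "\<dots> = m ^ l * (\<delta> * exp (a * real l ^ 2))"
      by (simp add: m_def power_mult_distrib)
    also have "\<dots> = \<delta> * (2 * real l) ^ l * exp (a * real l ^ 2) * b"
      using l by (simp add: b_def power_divide)
    finally show ?thesis using b0 by (simp add: divide_le_eq)
  qed
  finally show ?thesis by simp
qed

end

section \<open>The growth of balls\<close>

lemma steiner_weight_antimono:
  assumes "finite V" "A \<subseteq> V" "S \<subseteq> A" "A \<noteq> {}"
  shows "steiner_weight V w S \<le> steiner_weight A w S"
proof -
  have "finite A" using assms finite_subset by blast
  from steiner_weight_attained[OF this assms(3,4)] obtain U F
    where "(U, F) \<in> connecting_subgraphs A S" "steiner_weight A w S = sum w F" by blast
  then show ?thesis
    using steiner_weight_le[OF assms(1)] connecting_subgraphs_mono[of S S A V] assms(2) by auto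
qed

lemma steiner_weight_add_edge:
  assumes V: "finite V" "A \<subseteq> V" and w: "\<And>e. e \<in> complete_edges V \<Longrightarrow> w e \<ge> 0"
    and ab: "r \<in> A" "a \<in> A" "b \<in> V" "b \<noteq> a"
  shows "steiner_weight V w {r, b} \<le> steiner_weight A w {r, a} + w {a, b}"
proof -
  have "finite A" using V finite_subset by blast
  from steiner_weight_attained[OF this, of "{r, a}" w] ab obtain U F
    where UF: "(U, F) \<in> connecting_subgraphs A {r, a}" "steiner_weight A w {r, a} = sum w F" by blast
  have F: "F \<subseteq> complete_edges U" "U \<subseteq> A" "r \<in> U" "a \<in> U" "connected_graph U F"
    using UF(1) by (auto simp: connecting_subgraphs_def)
  have "{a, b} \<in> complete_edges (insert b U)"
    using F ab by (auto simp: pair_in_complete_edges)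
  then have "(insert b U, insert {a, b} F) \<in> connecting_subgraphs V {r, b}"
    using F V ab connected_graph_insert[OF F(5,4), of b] complete_edges_mono[of U "insert b U"]
    by (auto simp: connecting_subgraphs_def)
  from steiner_weight_le[OF V(1) this]
  have "steiner_weight V w {r, b} \<le> sum w (insert {a, b} F)" .
  also have "\<dots> \<le> sum w F + w {a, b}"
  proof -
    have "finite F" using F(1) finite_complete_edges[of U] F(2) \<open>finite A\<close> by (meson finite_subset)
    moreover have "w {a, b} \<ge> 0" using ab V by (intro w) (auto simp: pair_in_complete_edges)
    ultimately show ?thesis by (simp add: sum.insert_if)
  qed
  finally show ?thesis by (simp add: UF(2))
qed

text \<open>The part of an optimal subgraph that \<open>r\<close> reaches inside \<open>A\<close> is
  \<open>(U', F')\<close>. Some edge of the subgraph leaves \<open>U'\<close>, and by the choice of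
  \<open>U'\<close> it leaves \<open>A\<close> too; it is not in \<open>F'\<close>, so both weights
  add up within the subgraph.\<close>

lemma steiner_weight_crossing:
  assumes V: "finite V" "A \<subseteq> V" and w: "\<And>e. e \<in> complete_edges V \<Longrightarrow> w e \<ge> 0"
    and v: "r \<in> A" "v \<in> V" "v \<notin> A"
  obtains a b where "a \<in> A" "b \<in> V - A" "steiner_weight A w {r, a} + w {a, b} \<le> steiner_weight V w {r, v}"
proof -
  have finA: "finite A" using V finite_subset by blast
  from steiner_weight_attained[OF V(1), of "{r, v}" w] v V obtain U F
    where UF: "(U, F) \<in> connecting_subgraphs V {r, v}" "steiner_weight V w {r, v} = sum w F" by blast
  have F: "F \<subseteq> complete_edges U" "U \<subseteq> V" "r \<in> U" "v \<in> U" "connected_graph U F"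
    using UF(1) by (auto simp: connecting_subgraphs_def)
  define R where "R = {(x, y). {x, y} \<in> F \<and> x \<in> A \<and> y \<in> A}"
  define U' where "U' = R\<^sup>* `` {r}"
  define F' where "F' = {e \<in> F. e \<subseteq> U'}"
  have U': "r \<in> U'" "U' \<subseteq> A"
  proof -
    show "r \<in> U'" by (simp add: U'_def)
    have "u \<in> A" if "(r, u) \<in> R\<^sup>*" for u using that by induction (use v in \<open>auto simp: R_def\<close>)
    then show "U' \<subseteq> A" by (auto simp: U'_def)
  qed
  have conn: "connected_graph U' F'"
  proof (rule connected_graphI_root[OF U'(1)])
    fix u assume "u \<in> U'"
    then have "(r, u) \<in> R\<^sup>*" by (simp add: U'_def)
    then show "(r, u) \<in> {(x, y). {x, y} \<in> F'}\<^sup>*"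
    proof induction
      case (step y z)
      then have "(r, z) \<in> R\<^sup>*" by simp
      with step have "{y, z} \<in> F'" by (auto simp: F'_def U'_def R_def)
      with step.IH show ?case by (auto intro: rtrancl_into_rtrancl)
    qed simp
  qed
  have "\<exists>x y. x \<in> U' \<and> y \<notin> U' \<and> {x, y} \<in> F"
  proof -
    have "z \<notin> U' \<longrightarrow> (\<exists>x y. x \<in> U' \<and> y \<notin> U' \<and> {x, y} \<in> F)"
      if "(r, z) \<in> {(x, y). {x, y} \<in> F}\<^sup>*" for z
      using that by induction (use U' in auto)
    moreover have "(r, v) \<in> {(x, y). {x, y} \<in> F}\<^sup>*" using F by (auto simp: connected_graph_def)
    ultimately show ?thesis using U' v by auto
  qed
  then obtain x y where xy: "x \<in> U'" "y \<notin> U'" "{x, y} \<in> F" by blast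
  have "y \<notin> A"
  proof
    assume "y \<in> A"
    then have "(x, y) \<in> R" using xy U' by (auto simp: R_def)
    then show False using xy by (auto simp: U'_def intro: rtrancl_into_rtrancl)
  qed
  have FV: "F \<subseteq> complete_edges V" using connecting_subgraphs_edges[OF UF(1)] .
  have yV: "y \<in> V" using subsetD[OF FV xy(3)] by (simp add: pair_in_complete_edges)
  have finF: "finite F" using FV finite_complete_edges[OF V(1)] finite_subset by blast
  have "F' \<subseteq> complete_edges U'" using F(1) by (auto simp: F'_def complete_edges_def)
  then have "(U', F') \<in> connecting_subgraphs A {r, x}"
    using U' xy conn by (auto simp: connecting_subgraphs_def)
  then have "steiner_weight A w {r, x} + w {x, y} \<le> sum w F' + w {x, y}"
    using steiner_weight_le[OF finA] by auto
  also have "\<dots> = sum w (insert {x, y} F')"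
    using xy finF by (subst sum.insert) (auto simp: F'_def)
  also have "\<dots> \<le> sum w F"
    using xy finF FV by (intro sum_mono2) (auto simp: F'_def intro!: w)
  finally show thesis using that[of x y] U' xy \<open>y \<notin> A\<close> yV UF(2) by auto
qed

section \<open>Balls described by the edges inside a set and across its boundary\<close>

definition crossing :: "'v set \<Rightarrow> 'v set \<Rightarrow> 'v set set" where
  "crossing V A = (\<lambda>(a, b). {a, b}) ` (A \<times> (V - A))"

text \<open>Distances are measured inside \<open>A\<close>, so only inner edges matter. If
  \<open>A\<close> is a ball around \<open>r\<close>, they agree with the distances in the whole
  graph, and the radius is the time at which the ball has just become \<open>A\<close>.\<close>

definition radius :: "'v \<Rightarrow> 'v set \<Rightarrow> ('v set \<Rightarrow> real) \<Rightarrow> real" where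
  "radius r A w = Max ((\<lambda>a. steiner_weight A w {r, a}) ` A)"

text \<open>Indexed by the edge, not by its endpoints, to fit a product measure over edges. A
  crossing edge meets \<open>A\<close> in a single vertex, so \<open>Min\<close> ranges over one
  value.\<close>

definition slack :: "'v \<Rightarrow> 'v set \<Rightarrow> ('v set \<Rightarrow> real) \<Rightarrow> 'v set \<Rightarrow> real" where
  "slack r A w e = radius r A w - Min ((\<lambda>a. steiner_weight A w {r, a}) ` (e \<inter> A))"

text \<open>\<open>surrounded V r A s w\<close> says that \<open>A\<close> is still the ball around \<open>r\<close> at time \<open>s\<close> after it was filled.
  The slack of a crossing edge is the time for which it has been explored when \<open>A\<close> is filled; it
  depends only on the edges inside \<open>A\<close>.\<close>

definition surrounded :: "'v set \<Rightarrow> 'v \<Rightarrow> 'v set \<Rightarrow> real \<Rightarrow> ('v set \<Rightarrow> real) \<Rightarrow> bool" where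
  "surrounded V r A s w \<longleftrightarrow> (\<forall>e\<in>crossing V A. s + slack r A w e < w e)"

lemma slack_pair: "a \<in> A \<Longrightarrow> b \<notin> A \<Longrightarrow> slack r A w {a, b} = radius r A w - steiner_weight A w {r, a}"
  by (simp add: slack_def)

lemma surrounded_iff:
  "surrounded V r A s w \<longleftrightarrow>
    (\<forall>a\<in>A. \<forall>b\<in>V - A. s + radius r A w < steiner_weight A w {r, a} + w {a, b})"
proof -
  have "s + slack r A w {a, b} < w {a, b} \<longleftrightarrow> s + radius r A w < steiner_weight A w {r, a} + w {a, b}"
    if "a \<in> A" "b \<in> V - A" for a b
    using that by (auto simp: slack_pair)
  then show ?thesis unfolding surrounded_def crossing_def by auto
qed

lemma crossing_subset: "A \<subseteq> V \<Longrightarrow> crossing V A \<subseteq> complete_edges V - complete_edges A"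
  by (auto simp: crossing_def pair_in_complete_edges)

lemma card_crossing:
  assumes "finite V" "A \<subseteq> V"
  shows "card (crossing V A) = card A * (card V - card A)"
proof -
  have "inj_on (\<lambda>(a, b). {a, b}) (A \<times> (V - A))" by (auto simp: inj_on_def doubleton_eq_iff)
  then show ?thesis using assms
    by (simp add: crossing_def card_image card_cartesian_product card_Diff_subset finite_subset)
qed

text \<open>All vertices of an optimal subgraph for \<open>{r, a}\<close> are themselves at distance
  at most \<open>t\<close>, so it stays inside the ball and the inner distances are at most
  \<open>t\<close>; an edge leaving the ball must lead to a vertex beyond \<open>t\<close>.\<close>

lemma ball_eq_imp_surrounded:
  assumes V: "finite V" "r \<in> A" and w: "\<And>e. e \<in> complete_edges V \<Longrightarrow> w e \<ge> 0"
    and A: "A = {v \<in> V. steiner_weight V w {r, v} \<le> t}"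
  shows "radius r A w \<le> t \<and> surrounded V r A (t - radius r A w) w"
proof
  have AV: "A \<subseteq> V" and finA: "finite A" using A V by auto
  have "steiner_weight A w {r, a} \<le> t" if "a \<in> A" for a
  proof -
    from steiner_weight_attained[OF V(1), of "{r, a}" w] V AV that obtain U F
      where UF: "(U, F) \<in> connecting_subgraphs V {r, a}" "steiner_weight V w {r, a} = sum w F" by blast
    have "U \<subseteq> A"
    proof
      fix u assume u: "u \<in> U"
      then have "(U, F) \<in> connecting_subgraphs V {r, u}"
        using UF(1) by (auto simp: connecting_subgraphs_def)
      from steiner_weight_le[OF V(1) this, of w] UF that A u show "u \<in> A"
        by (auto simp: connecting_subgraphs_def)
    qed
    then have "(U, F) \<in> connecting_subgraphs A {r, a}" using UF(1) by (auto simp: connecting_subgraphs_def)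
    from steiner_weight_le[OF finA this, of w] UF(2) that A show ?thesis by auto
  qed
  then show "radius r A w \<le> t" unfolding radius_def using V finA by (intro Max.boundedI) auto
  have "t < steiner_weight A w {r, a} + w {a, b}" if "a \<in> A" "b \<in> V - A" for a b
    using steiner_weight_add_edge[OF V(1) AV w V(2) that(1), where b = b] that A by force
  then show "surrounded V r A (t - radius r A w) w" by (auto simp: surrounded_iff)
qed

text \<open>A vertex outside \<open>A\<close> is reached only through a crossing edge, and none has
  been fully explored when \<open>A\<close> is filled.\<close>

lemma surrounded_imp_ball_eq:
  assumes V: "finite V" "r \<in> A" "A \<subseteq> V" and w: "\<And>e. e \<in> complete_edges V \<Longrightarrow> w e \<ge> 0"
    and s: "surrounded V r A 0 w"
  shows "A = {v \<in> V. steiner_weight V w {r, v} \<le> radius r A w}"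
proof (intro set_eqI iffI)
  have finA: "finite A" using V finite_subset by blast
  fix v assume v: "v \<in> A"
  then have "steiner_weight V w {r, v} \<le> steiner_weight A w {r, v}"
    using V by (intro steiner_weight_antimono) auto
  also have "\<dots> \<le> radius r A w" unfolding radius_def using v finA by (intro Max_ge) auto
  finally show "v \<in> {v \<in> V. steiner_weight V w {r, v} \<le> radius r A w}" using v V by auto
next
  fix v assume v: "v \<in> {v \<in> V. steiner_weight V w {r, v} \<le> radius r A w}"
  show "v \<in> A"
  proof (rule ccontr)
    assume "v \<notin> A"
    with v obtain a b where "a \<in> A" "b \<in> V - A"
      "steiner_weight A w {r, a} + w {a, b} \<le> steiner_weight V w {r, v}"
      using steiner_weight_crossing[where w = w and v = v, OF V(1,3) w V(2)] by blast
    with s v show False by (force simp: surrounded_iff)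
  qed
qed

text \<open>Balls around \<open>r\<close> are nested, so two of the same size coincide.\<close>

lemma surrounded_same_card:
  assumes "finite V" "r \<in> A" "A \<subseteq> V" "r \<in> A'" "A' \<subseteq> V" "card A = card A'"
    and w: "\<And>e. e \<in> complete_edges V \<Longrightarrow> w e \<ge> 0"
    and "surrounded V r A 0 w" "surrounded V r A' 0 w"
  shows "A = A'"
proof -
  have eq: "A = {v \<in> V. steiner_weight V w {r, v} \<le> radius r A w}"
    "A' = {v \<in> V. steiner_weight V w {r, v} \<le> radius r A' w}"
    using assms by (intro surrounded_imp_ball_eq; simp)+
  have "A \<subseteq> A' \<or> A' \<subseteq> A"
    by (cases "radius r A w \<le> radius r A' w") (subst eq, subst eq(2), force)+
  moreover have "finite A" "finite A'" using assms finite_subset by blast+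
  ultimately show ?thesis using assms(6) card_subset_eq by metis
qed

section \<open>The joint law of the weights and the memoryless property\<close>

abbreviation unit_exponential :: "real measure" where
  "unit_exponential \<equiv> density lborel (\<lambda>x. ennreal (exponential_density 1 x))"

lemma prob_space_unit_exponential: "prob_space unit_exponential"
  by (rule prob_space_exponential_density) simp

lemma borel_measurable_slack:
  assumes "finite A" "\<And>e. e \<in> complete_edges A \<Longrightarrow> (\<lambda>x. X x e) \<in> borel_measurable N"
  shows "(\<lambda>x. slack r A (X x) e) \<in> borel_measurable N"
  unfolding slack_def radius_def using assms
  by (intro borel_measurable_diff borel_measurable_Max borel_measurable_Min borel_measurable_steiner_weight) auto

lemma slack_cong:
  assumes "\<And>e. e \<in> complete_edges A \<Longrightarrow> w e = w' e"
  shows "slack r A w = slack r A w'"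
  unfolding slack_def[abs_def] radius_def using steiner_weight_cong[of A w w', OF assms] by simp

lemma slack_nonneg:
  assumes "finite V" "A \<subseteq> V" "e \<in> crossing V A"
  shows "slack r A w e \<ge> 0"
proof -
  obtain a b where ab: "e = {a, b}" "a \<in> A" "b \<notin> A" using assms(3) by (auto simp: crossing_def)
  have "finite A" using assms finite_subset by blast
  then have "steiner_weight A w {r, a} \<le> radius r A w"
    unfolding radius_def using ab by (intro Max_ge) auto
  then show ?thesis using ab by (simp add: slack_pair)
qed

context exponential_weights
begin

lemma distr_weights:
  assumes I: "I \<subseteq> complete_edges V" "I \<noteq> {}"
  shows "distr M (\<Pi>\<^sub>M i\<in>I. borel) (\<lambda>\<omega>. \<lambda>i\<in>I. T i \<omega>) = (\<Pi>\<^sub>M i\<in>I. unit_exponential)"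
proof -
  have "distr M (\<Pi>\<^sub>M i\<in>I. borel) (\<lambda>\<omega>. \<lambda>i\<in>I. T i \<omega>) = (\<Pi>\<^sub>M i\<in>I. distr M borel (T i))"
    using indep_vars_subset[OF indep I(1)] I weight_measurable
    by (subst indep_vars_iff_distr_eq_PiM'[symmetric]) auto
  also have "\<dots> = (\<Pi>\<^sub>M i\<in>I. unit_exponential)"
  proof (rule PiM_cong[OF refl])
    fix i assume "i \<in> I"
    then have "distr M lborel (T i) = unit_exponential"
      using I by (intro distributed_distr_eq_density exponential) auto
    then show "distr M borel (T i) = unit_exponential"
      by (metis distr_cong sets_lborel)
  qed
  finally show ?thesis .
qed

lemma nn_integral_weights:
  assumes I: "I \<subseteq> complete_edges V" "I \<noteq> {}" and f: "f \<in> borel_measurable (\<Pi>\<^sub>M i\<in>I. borel)"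
  shows "(\<integral>\<^sup>+\<omega>. f (\<lambda>i\<in>I. T i \<omega>) \<partial>M) = (\<integral>\<^sup>+x. f x \<partial>(\<Pi>\<^sub>M i\<in>I. unit_exponential))"
proof -
  have "(\<lambda>\<omega>. \<lambda>i\<in>I. T i \<omega>) \<in> M \<rightarrow>\<^sub>M (\<Pi>\<^sub>M i\<in>I. borel)"
    using I weight_measurable by (intro measurable_restrict) auto
  then have "(\<integral>\<^sup>+\<omega>. f (\<lambda>i\<in>I. T i \<omega>) \<partial>M) = (\<integral>\<^sup>+x. f x \<partial>distr M (\<Pi>\<^sub>M i\<in>I. borel) (\<lambda>\<omega>. \<lambda>i\<in>I. T i \<omega>))"
    using f by (simp add: nn_integral_distr)
  then show ?thesis by (simp add: distr_weights[OF I])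
qed

text \<open>Fubini over the independent blocks \<open>I\<close> and \<open>J\<close>: once the
  weights in \<open>I\<close> are fixed the thresholds are constants, and the tail at
  \<open>s + y e x\<close> factors. All dependence on \<open>s\<close> comes out of the integral,
  which is the memoryless property in the form needed.\<close>

lemma emeasure_thresholds:
  assumes IJ: "I \<subseteq> complete_edges V" "J \<subseteq> complete_edges V" "I \<inter> J = {}" "J \<noteq> {}"
    and y: "\<And>e. e \<in> J \<Longrightarrow> y e \<in> borel_measurable (\<Pi>\<^sub>M i\<in>I. borel)" "\<And>e x. e \<in> J \<Longrightarrow> y e x \<ge> 0"
    and s: "s \<ge> (0::real)"
  shows "emeasure M {\<omega> \<in> space M. \<forall>e\<in>J. s + y e (\<lambda>i\<in>I. T i \<omega>) < T e \<omega>} =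
    ennreal (exp (- s * card J)) * (\<integral>\<^sup>+x. (\<Prod>e\<in>J. ennreal (exp (- y e x))) \<partial>(\<Pi>\<^sub>M i\<in>I. unit_exponential))"
proof -
  interpret product_sigma_finite "\<lambda>_::'v set. unit_exponential"
    by (intro product_sigma_finite.intro prob_space_imp_sigma_finite prob_space_unit_exponential)
  have fin: "finite I" "finite J" using IJ finite_edges by auto
  define f where "f x = (\<Prod>e\<in>J. if s + y e (restrict x I) < x e then 1 else 0 :: ennreal)" for x
  have f[measurable]: "f \<in> borel_measurable (\<Pi>\<^sub>M i\<in>I \<union> J. borel)"
    unfolding f_def[abs_def]
  proof (intro borel_measurable_prod_ennreal)
    fix e assume e: "e \<in> J"
    have [measurable]: "(\<lambda>x. y e (restrict x I)) \<in> borel_measurable (\<Pi>\<^sub>M i\<in>I \<union> J. borel)"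
      by (rule measurable_compose[OF measurable_restrict_subset y(1)[OF e]]) simp
    have [measurable]: "(\<lambda>x. x e) \<in> borel_measurable (\<Pi>\<^sub>M i\<in>I \<union> J. borel :: real measure)"
      using e by (intro measurable_component_singleton) auto
    show "(\<lambda>x. if s + y e (restrict x I) < x e then 1 else 0 :: ennreal) \<in> borel_measurable (\<Pi>\<^sub>M i\<in>I \<union> J. borel)"
      by measurable
  qed
  have sets_eq: "sets (\<Pi>\<^sub>M i\<in>K. unit_exponential) = sets (\<Pi>\<^sub>M i\<in>K. borel)" for K :: "'v set set"
    by (rule sets_PiM_cong) auto
  \<comment> \<open>Read off from the law of an actual edge, which exists because \<open>J\<close>
    is nonempty.\<close>
  have tail: "(\<integral>\<^sup>+z. (if c < z then 1 else 0) \<partial>unit_exponential) = ennreal (exp (- c))" if "c \<ge> 0" for c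
  proof -
    obtain e where e: "e \<in> J" using IJ by auto
    note D = exponential[OF subsetD[OF IJ(2) e]]
    note [measurable] = weight_measurable[OF subsetD[OF IJ(2) e]]
    have "(\<integral>\<^sup>+z. (if c < z then 1 else 0) \<partial>unit_exponential) = (\<integral>\<^sup>+z. indicator {c<..} z \<partial>unit_exponential)"
      by (intro nn_integral_cong) (auto simp: indicator_def)
    also have "\<dots> = emeasure unit_exponential {c<..}" by (rule nn_integral_indicator) simp
    also have "\<dots> = emeasure (distr M lborel (T e)) {c<..}"
      by (simp add: distributed_distr_eq_density[OF D])
    also have "\<dots> = emeasure M {\<omega> \<in> space M. c < T e \<omega>}"
      by (subst emeasure_distr) (auto intro!: arg_cong[where f = "emeasure M"])
    also have "\<dots> = ennreal (exp (- c))"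
      using exponential_distributedD_gt[OF D that] by (simp add: emeasure_eq_measure)
    finally show ?thesis .
  qed
  have restr: "restrict (\<lambda>i\<in>I \<union> J. T i \<omega>) I = (\<lambda>i\<in>I. T i \<omega>)" for \<omega>
    by (auto simp: restrict_def)
  have meas: "{\<omega> \<in> space M. \<forall>e\<in>J. s + y e (\<lambda>i\<in>I. T i \<omega>) < T e \<omega>} \<in> events"
  proof -
    have "Measurable.pred M (\<lambda>\<omega>. \<forall>e\<in>J. s + y e (\<lambda>i\<in>I. T i \<omega>) < T e \<omega>)"
    proof (intro pred_intros_finite fin)
      fix e assume e: "e \<in> J"
      have "(\<lambda>\<omega>. \<lambda>i\<in>I. T i \<omega>) \<in> M \<rightarrow>\<^sub>M (\<Pi>\<^sub>M i\<in>I. borel)"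
        using IJ weight_measurable by (intro measurable_restrict) auto
      from measurable_compose[OF this y(1)[OF e]]
      have [measurable]: "(\<lambda>\<omega>. y e (\<lambda>i\<in>I. T i \<omega>)) \<in> borel_measurable M" .
      have [measurable]: "T e \<in> borel_measurable M" using e IJ by (intro weight_measurable) auto
      show "Measurable.pred M (\<lambda>\<omega>. s + y e (\<lambda>i\<in>I. T i \<omega>) < T e \<omega>)" by measurable
    qed
    then show ?thesis by (simp add: pred_def)
  qed
  have "emeasure M {\<omega> \<in> space M. \<forall>e\<in>J. s + y e (\<lambda>i\<in>I. T i \<omega>) < T e \<omega>} =
      (\<integral>\<^sup>+\<omega>. indicator {\<omega> \<in> space M. \<forall>e\<in>J. s + y e (\<lambda>i\<in>I. T i \<omega>) < T e \<omega>} \<omega> \<partial>M)"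
    using meas by simp
  also have "\<dots> = (\<integral>\<^sup>+\<omega>. f (\<lambda>i\<in>I \<union> J. T i \<omega>) \<partial>M)"
    using fin by (intro nn_integral_cong) (auto simp: f_def restr indicator_def prod_zero_iff intro!: prod.neutral[symmetric])
  also have "\<dots> = (\<integral>\<^sup>+x. f x \<partial>(\<Pi>\<^sub>M i\<in>I \<union> J. unit_exponential))"
    using IJ by (intro nn_integral_weights f) auto
  also have "\<dots> = (\<integral>\<^sup>+x. (\<integral>\<^sup>+z. f (merge I J (x, z)) \<partial>(\<Pi>\<^sub>M i\<in>J. unit_exponential)) \<partial>(\<Pi>\<^sub>M i\<in>I. unit_exponential))"
    using f by (intro product_nn_integral_fold IJ(3) fin) (simp add: measurable_cong_sets[OF sets_eq refl])
  also have "\<dots> = (\<integral>\<^sup>+x. ennreal (exp (- s * card J)) * (\<Prod>e\<in>J. ennreal (exp (- y e x))) \<partial>(\<Pi>\<^sub>M i\<in>I. unit_exponential))"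
  proof (rule nn_integral_cong)
    fix x assume x: "x \<in> space (\<Pi>\<^sub>M i\<in>I. unit_exponential)"
    then have rx: "restrict x I = x" by (auto simp: space_PiM extensional_restrict PiE_def)
    have "(\<integral>\<^sup>+z. f (merge I J (x, z)) \<partial>(\<Pi>\<^sub>M i\<in>J. unit_exponential)) =
        (\<integral>\<^sup>+z. (\<Prod>e\<in>J. if s + y e x < z e then 1 else 0) \<partial>(\<Pi>\<^sub>M i\<in>J. unit_exponential))"
      using IJ(3) by (intro nn_integral_cong) (auto simp: f_def rx intro!: prod.cong)
    also have "\<dots> = (\<Prod>e\<in>J. \<integral>\<^sup>+z. (if s + y e x < z then 1 else 0) \<partial>unit_exponential)"
      by (rule product_nn_integral_prod[OF fin(2)]) measurable
    also have "\<dots> = (\<Prod>e\<in>J. ennreal (exp (- s)) * ennreal (exp (- y e x)))"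
      using s y(2) by (intro prod.cong refl) (subst tail, auto simp: ennreal_mult[symmetric] exp_add[symmetric])
    also have "\<dots> = ennreal (exp (- s * card J)) * (\<Prod>e\<in>J. ennreal (exp (- y e x)))"
      by (simp add: prod.distrib ennreal_power exp_of_nat_mult[symmetric] mult.commute)
    finally show "(\<integral>\<^sup>+z. f (merge I J (x, z)) \<partial>(\<Pi>\<^sub>M i\<in>J. unit_exponential)) =
      ennreal (exp (- s * card J)) * (\<Prod>e\<in>J. ennreal (exp (- y e x)))" .
  qed
  also have "\<dots> = ennreal (exp (- s * card J)) * (\<integral>\<^sup>+x. (\<Prod>e\<in>J. ennreal (exp (- y e x))) \<partial>(\<Pi>\<^sub>M i\<in>I. unit_exponential))"
  proof (intro nn_integral_cmult borel_measurable_prod_ennreal)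
    fix e assume "e \<in> J"
    from y(1)[OF this] have [measurable]: "y e \<in> borel_measurable (\<Pi>\<^sub>M i\<in>I. unit_exponential)"
      by (simp add: measurable_cong_sets[OF sets_eq refl])
    show "(\<lambda>x. ennreal (exp (- y e x))) \<in> borel_measurable (\<Pi>\<^sub>M i\<in>I. unit_exponential)" by measurable
  qed
  finally show ?thesis .
qed

lemma emeasure_surrounded:
  assumes A: "r \<in> A" "A \<subset> V" and s: "s \<ge> 0"
  shows "emeasure M {\<omega> \<in> space M. surrounded V r A s (\<lambda>e. T e \<omega>)} =
    ennreal (exp (- s * (card A * (card V - card A)))) * emeasure M {\<omega> \<in> space M. surrounded V r A 0 (\<lambda>e. T e \<omega>)}"
proof -
  \<comment> \<open>Empty when \<open>A = {r}\<close>; only the block \<open>J\<close> has to be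
    nonempty.\<close>
  define I where "I = complete_edges A"
  define J where "J = crossing V A"
  have finA: "finite A" using A finite_vertices finite_subset by blast
  have J: "J \<subseteq> complete_edges V - I" using crossing_subset[of A V] A by (auto simp: I_def J_def)
  have Jne: "J \<noteq> {}" using A by (auto simp: J_def crossing_def)
  have cJ: "card J = card A * (card V - card A)"
    using A by (auto simp: J_def intro!: card_crossing finite_vertices)
  have eq: "slack r A (\<lambda>e. T e \<omega>) = slack r A (\<lambda>i\<in>I. T i \<omega>)" for \<omega>
    by (rule slack_cong) (simp add: I_def)
  have y: "(\<lambda>x. slack r A x e) \<in> borel_measurable (\<Pi>\<^sub>M i\<in>I. borel)" for e
    by (rule borel_measurable_slack[OF finA]) (auto simp: I_def)
  have "emeasure M {\<omega> \<in> space M. surrounded V r A t (\<lambda>e. T e \<omega>)} =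
      ennreal (exp (- t * card J)) * (\<integral>\<^sup>+x. (\<Prod>e\<in>J. ennreal (exp (- slack r A x e))) \<partial>(\<Pi>\<^sub>M i\<in>I. unit_exponential))"
    if "t \<ge> 0" for t
    unfolding surrounded_def J_def[symmetric] eq
    using J Jne complete_edges_mono[of A V] A y that slack_nonneg[OF finite_vertices, of A _ r]
    by (intro emeasure_thresholds[where y = "\<lambda>e x. slack r A x e"]) (auto simp: I_def J_def)
  from this[OF s] this[of 0] show ?thesis by (simp add: cJ)
qed

section \<open>Occupation times and mean distances\<close>

definition occupation :: "'v \<Rightarrow> 'v set \<Rightarrow> 'a \<Rightarrow> ennreal" where
  "occupation r A \<omega> = (\<integral>\<^sup>+s. indicator {0..} s * indicator {s. surrounded V r A s (\<lambda>e. T e \<omega>)} s \<partial>lborel)"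

lemma surrounded_measurable:
  assumes A: "A \<subseteq> V"
  shows "Measurable.pred (M \<Otimes>\<^sub>M lborel) (\<lambda>(\<omega>, s). surrounded V r A s (\<lambda>e. T e \<omega>))"
proof -
  have finA: "finite A" using A finite_vertices finite_subset by blast
  have "Measurable.pred (M \<Otimes>\<^sub>M lborel) (\<lambda>p. \<forall>e\<in>crossing V A. snd p + slack r A (\<lambda>e. T e (fst p)) e < T e (fst p))"
  proof (intro pred_intros_finite)
    show "finite (crossing V A)" using crossing_subset[OF A] by (intro finite_edges) auto
    fix e assume e: "e \<in> crossing V A"
    have [measurable]: "T e \<in> borel_measurable M"
      using crossing_subset[OF A] e by (intro weight_measurable) auto
    have [measurable]: "(\<lambda>\<omega>. slack r A (\<lambda>e. T e \<omega>) e) \<in> borel_measurable M"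
      using complete_edges_mono[OF A] by (intro borel_measurable_slack[OF finA] weight_measurable) auto
    show "Measurable.pred (M \<Otimes>\<^sub>M lborel) (\<lambda>p. snd p + slack r A (\<lambda>e. T e (fst p)) e < T e (fst p))"
      by measurable
  qed
  then show ?thesis by (simp add: surrounded_def case_prod_beta)
qed

lemma occupation_measurable: "A \<subseteq> V \<Longrightarrow> occupation r A \<in> borel_measurable M"
proof -
  assume A: "A \<subseteq> V"
  note [measurable] = surrounded_measurable[OF A]
  interpret pair_sigma_finite M "lborel :: real measure" ..
  have "(\<lambda>(\<omega>, s). indicator {0..} s * indicator {s. surrounded V r A s (\<lambda>e. T e \<omega>)} s :: ennreal)
    \<in> borel_measurable (M \<Otimes>\<^sub>M lborel)"
    by measurable
  then show ?thesis unfolding occupation_def[abs_def] by measurable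
qed

text \<open>Exchange the integrals over time and weights; by \<open>emeasure_surrounded\<close> what
  remains is the integral of exp(- m s) over s \<ge> 0, with \<open>m\<close> the number of crossing
  edges.\<close>

lemma nn_integral_occupation:
  assumes A: "r \<in> A" "A \<subset> V"
  shows "(\<integral>\<^sup>+\<omega>. occupation r A \<omega> \<partial>M) =
    ennreal (1 / (card A * (card V - card A))) * emeasure M {\<omega> \<in> space M. surrounded V r A 0 (\<lambda>e. T e \<omega>)}"
proof -
  interpret pair_sigma_finite M "lborel :: real measure" ..
  let ?P = "emeasure M {\<omega> \<in> space M. surrounded V r A 0 (\<lambda>e. T e \<omega>)}"
  define m :: real where "m = card A * (card V - card A)"
  have m: "m > 0"
  proof -
    have "finite A" using A finite_vertices finite_subset by blast
    then have "card A > 0" using A by (auto simp: card_gt_0_iff)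
    then show ?thesis using psubset_card_mono[OF finite_vertices A(2)] by (simp add: m_def)
  qed
  have AV: "A \<subseteq> V" using A by auto
  note [measurable] = surrounded_measurable[OF AV]
  have "(\<integral>\<^sup>+\<omega>. occupation r A \<omega> \<partial>M) =
      (\<integral>\<^sup>+s. (\<integral>\<^sup>+\<omega>. indicator {0..} s * indicator {s. surrounded V r A s (\<lambda>e. T e \<omega>)} s \<partial>M) \<partial>lborel)"
    unfolding occupation_def by (rule Fubini'[symmetric]) measurable
  also have "\<dots> = (\<integral>\<^sup>+s. ?P * (ennreal (exp (- m * s)) * indicator {0..} s) \<partial>lborel)"
  proof (rule nn_integral_cong)
    fix s :: real
    have "(\<integral>\<^sup>+\<omega>. indicator {0..} s * indicator {s. surrounded V r A s (\<lambda>e. T e \<omega>)} s \<partial>M) =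
        (\<integral>\<^sup>+\<omega>. indicator {0..} s * indicator {\<omega> \<in> space M. surrounded V r A s (\<lambda>e. T e \<omega>)} \<omega> \<partial>M)"
      by (intro nn_integral_cong) (auto simp: indicator_def)
    also have "\<dots> = indicator {0..} s * emeasure M {\<omega> \<in> space M. surrounded V r A s (\<lambda>e. T e \<omega>)}"
      by (subst nn_integral_cmult_indicator) auto
    also have "\<dots> = ?P * (ennreal (exp (- m * s)) * indicator {0..} s)"
      using emeasure_surrounded[OF A, of s] by (auto simp: indicator_def m_def mult_ac)
    finally show "(\<integral>\<^sup>+\<omega>. indicator {0..} s * indicator {s. surrounded V r A s (\<lambda>e. T e \<omega>)} s \<partial>M)
      = ?P * (ennreal (exp (- m * s)) * indicator {0..} s)" .
  qed
  also have "\<dots> = ?P * (\<integral>\<^sup>+s. ennreal (exp (- m * s)) * indicator {0..} s \<partial>lborel)"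
    by (rule nn_integral_cmult) measurable
  also have "(\<integral>\<^sup>+s. ennreal (exp (- m * s)) * indicator {0..} s \<partial>lborel) = ennreal (0 - (- exp (- m * 0) / m))"
  proof (rule nn_integral_FTC_atLeast)
    show "DERIV (\<lambda>x. - exp (- m * x) / m) x :> exp (- m * x)" for x
      using m by (auto intro!: derivative_eq_intros)
    have "LIM x at_top. (- m) * x :> at_bot"
      using m by (intro filterlim_tendsto_neg_mult_at_bot[OF tendsto_const _ filterlim_ident]) simp
    then have "((\<lambda>x. exp (- m * x)) \<longlongrightarrow> 0) at_top" by (rule filterlim_compose[OF exp_at_bot])
    then have "((\<lambda>x. - exp (- m * x) / m) \<longlongrightarrow> - 0 / m) at_top"
      using m by (intro tendsto_intros) auto
    then show "((\<lambda>x. - exp (- m * x) / m) \<longlongrightarrow> 0) at_top" by simp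
  qed auto
  finally show ?thesis by (simp add: m_def mult.commute)
qed

definition partial_balls :: "'v \<Rightarrow> 'v set set" where
  "partial_balls r = {A. r \<in> A \<and> A \<subset> V}"

lemma finite_partial_balls: "finite (partial_balls r)"
  by (rule finite_subset[of _ "Pow V"]) (auto simp: partial_balls_def finite_vertices)

text \<open>At every time before the distance to \<open>v\<close>, the ball around \<open>r\<close>
  is some set that misses \<open>v\<close>, and that set is then surrounded. The shift by
  \<open>radius r A ?w\<close> passes from the time since the start to the time since
  \<open>A\<close> was filled, and Lebesgue measure ignores it.\<close>

lemma dist_le_occupation:
  assumes r: "r \<in> V" and v: "v \<in> V" and pos: "\<forall>e\<in>complete_edges V. 0 \<le> T e \<omega>"
  shows "ennreal (steiner_weight V (\<lambda>e. T e \<omega>) {r, v})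
    \<le> (\<Sum>A\<in>partial_balls r. if v \<in> A then 0 else occupation r A \<omega>)"
proof -
  let ?w = "\<lambda>e. T e \<omega>"
  define d where "d = steiner_weight V ?w {r, v}"
  define \<S> where "\<S> = {A \<in> partial_balls r. v \<notin> A}"
  define g where "g A s = (indicator {0..} s * indicator {s. surrounded V r A s ?w} s :: ennreal)" for A and s :: real
  have fin: "finite \<S>" by (simp add: \<S>_def finite_partial_balls)
  have g[measurable]: "g A \<in> borel_measurable borel" if "A \<in> \<S>" for A
  proof -
    have "finite (crossing V A)"
      using crossing_subset[of A V] that by (intro finite_edges) (auto simp: \<S>_def partial_balls_def)
    then have [measurable]: "Measurable.pred borel (\<lambda>s. surrounded V r A s ?w)"
      unfolding surrounded_def by (intro pred_intros_finite) measurable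
    show ?thesis unfolding g_def[abs_def] by measurable
  qed
  have "ennreal d = emeasure lborel {0..<d}" by (cases "d \<ge> 0") (auto simp: ennreal_neg)
  also have "\<dots> = (\<integral>\<^sup>+t. indicator {0..<d} t \<partial>lborel)" by simp
  \<comment> \<open>The factor \<open>1 *\<close> is the form of an affine substitution, undone
    below by \<open>nn_integral_real_affine\<close>.\<close>
  also have "\<dots> \<le> (\<integral>\<^sup>+t. (\<Sum>A\<in>\<S>. g A (- radius r A ?w + 1 * t)) \<partial>lborel)"
  proof (rule nn_integral_mono)
    fix t :: real
    show "indicator {0..<d} t \<le> (\<Sum>A\<in>\<S>. g A (- radius r A ?w + 1 * t))"
    proof (cases "t \<in> {0..<d}")
      case True
      define A where "A = {u \<in> V. steiner_weight V ?w {r, u} \<le> t}"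
      have "({r}, {}) \<in> connecting_subgraphs V {r, r}"
        using r by (auto simp: connecting_subgraphs_def connected_graph_def)
      from steiner_weight_le[OF finite_vertices this, of ?w] True have rA: "r \<in> A"
        using r by (simp add: A_def)
      have "v \<notin> A" using True by (simp add: A_def d_def)
      then have A: "A \<in> \<S>" using rA v by (auto simp: \<S>_def partial_balls_def A_def)
      have "radius r A ?w \<le> t \<and> surrounded V r A (t - radius r A ?w) ?w"
        using pos by (intro ball_eq_imp_surrounded[OF finite_vertices rA _ A_def]) auto
      then have "g A (- radius r A ?w + 1 * t) = 1" by (simp add: g_def)
      then have "1 \<le> (\<Sum>A\<in>\<S>. g A (- radius r A ?w + 1 * t))"
        using member_le_sum[OF A _ fin, of "\<lambda>A. g A (- radius r A ?w + 1 * t)"] by simp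
      then show ?thesis using True by simp
    qed simp
  qed
  also have "\<dots> = (\<Sum>A\<in>\<S>. \<integral>\<^sup>+t. g A (- radius r A ?w + 1 * t) \<partial>lborel)"
    by (intro nn_integral_sum measurable_compose[OF _ g]) auto
  also have "\<dots> = (\<Sum>A\<in>\<S>. occupation r A \<omega>)"
  proof (rule sum.cong[OF refl])
    fix A assume "A \<in> \<S>"
    from nn_integral_real_affine[OF g[OF this], of 1 "- radius r A ?w"]
    show "(\<integral>\<^sup>+t. g A (- radius r A ?w + 1 * t) \<partial>lborel) = occupation r A \<omega>"
      unfolding occupation_def g_def by simp
  qed
  also have "\<dots> = (\<Sum>A\<in>partial_balls r. if v \<in> A then 0 else occupation r A \<omega>)"
    unfolding \<S>_def using finite_partial_balls by (intro sum.mono_neutral_cong_left) auto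
  finally show ?thesis by (simp add: d_def)
qed

lemma sum_prob_surrounded:
  assumes \<S>: "\<S> \<subseteq> partial_balls r" "\<And>A. A \<in> \<S> \<Longrightarrow> card A = j"
  shows "(\<Sum>A\<in>\<S>. emeasure M {\<omega> \<in> space M. surrounded V r A 0 (\<lambda>e. T e \<omega>)}) \<le> 1"
proof -
  define H where "H A = {\<omega> \<in> space M. surrounded V r A 0 (\<lambda>e. T e \<omega>)}" for A
  have fin: "finite \<S>" using \<S> finite_partial_balls finite_subset by blast
  have H[measurable]: "H A \<in> events" if "A \<in> \<S>" for A
  proof -
    have "A \<subseteq> V" using that \<S> by (auto simp: partial_balls_def)
    note [measurable] = surrounded_measurable[OF this]
    show ?thesis unfolding H_def by measurable
  qed
  have "(\<Sum>A\<in>\<S>. emeasure M (H A)) = (\<integral>\<^sup>+\<omega>. (\<Sum>A\<in>\<S>. indicator (H A) \<omega>) \<partial>M)"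
    using H by (subst nn_integral_sum) auto
  also have "\<dots> \<le> (\<integral>\<^sup>+\<omega>. 1 \<partial>M)"
  proof (rule nn_integral_mono_AE)
    from AE_weights_nonneg show "AE \<omega> in M. (\<Sum>A\<in>\<S>. indicator (H A) \<omega> :: ennreal) \<le> 1"
    proof eventually_elim
      case (elim \<omega>)
      have "A = A'" if "A \<in> \<S>" "A' \<in> \<S>" "\<omega> \<in> H A" "\<omega> \<in> H A'" for A A'
        using that \<S> elim
        by (intro surrounded_same_card[where w = "\<lambda>e. T e \<omega>", OF finite_vertices])
          (auto simp: H_def partial_balls_def)
      then have "card {A \<in> \<S>. \<omega> \<in> H A} \<le> Suc 0"
        using fin by (subst card_le_Suc0_iff_eq) auto
      moreover have "(\<Sum>A\<in>\<S>. indicator (H A) \<omega> :: ennreal) = of_nat (card {A \<in> \<S>. \<omega> \<in> H A})"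
        using fin by (simp add: indicator_def sum.If_cases Int_def)
      ultimately show ?case by (metis One_nat_def of_nat_1 of_nat_mono)
    qed
  qed
  also have "\<dots> = 1" by (simp add: emeasure_space_1)
  finally show ?thesis by (simp add: H_def)
qed

text \<open>Sets are grouped by size \<open>j\<close>: they share the denominator j (n - j), and
  their probabilities sum to at most 1. The weight \<open>c\<close> serves two uses, constant for
  the largest distance and n - j for the sum of all distances.\<close>

lemma sum_occupation:
  assumes c: "\<And>j. c j \<ge> (0::real)"
  shows "(\<Sum>A\<in>partial_balls r. ennreal (c (card A)) * (\<integral>\<^sup>+\<omega>. occupation r A \<omega> \<partial>M))
    \<le> ennreal (\<Sum>j = 1..<card V. c j / (real j * (real (card V) - real j)))"
proof -
  define H where "H A = {\<omega> \<in> space M. surrounded V r A 0 (\<lambda>e. T e \<omega>)}" for A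
  define q where "q j = c j / (real j * (real (card V) - real j))" for j
  have card_img: "card ` partial_balls r \<subseteq> {1..<card V}"
  proof
    fix j assume "j \<in> card ` partial_balls r"
    then obtain A where A: "r \<in> A" "A \<subset> V" "j = card A" by (auto simp: partial_balls_def)
    moreover have "finite A" using A finite_vertices finite_subset by blast
    moreover have "A \<noteq> {}" using A by auto
    ultimately show "j \<in> {1..<card V}" using psubset_card_mono[OF finite_vertices A(2)]
      by (simp add: Suc_le_eq card_gt_0_iff)
  qed
  have q: "q j \<ge> 0" if "j \<in> {1..<card V}" for j
    using that c by (auto simp: q_def)
  have "(\<Sum>A\<in>partial_balls r. ennreal (c (card A)) * (\<integral>\<^sup>+\<omega>. occupation r A \<omega> \<partial>M)) =
      (\<Sum>j = 1..<card V. \<Sum>A\<in>{A \<in> partial_balls r. card A = j}. ennreal (c (card A)) * (\<integral>\<^sup>+\<omega>. occupation r A \<omega> \<partial>M))"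
    by (rule sum.group[symmetric]) (use finite_partial_balls card_img in auto)
  also have "\<dots> \<le> (\<Sum>j = 1..<card V. ennreal (q j))"
  proof (rule sum_mono)
    fix j assume j: "j \<in> {1..<card V}"
    have "(\<Sum>A\<in>{A \<in> partial_balls r. card A = j}. ennreal (c (card A)) * (\<integral>\<^sup>+\<omega>. occupation r A \<omega> \<partial>M)) =
      (\<Sum>A\<in>{A \<in> partial_balls r. card A = j}. ennreal (q j) * emeasure M (H A))"
    proof (rule sum.cong[OF refl], clarify)
      fix A assume A: "A \<in> partial_balls r" "j = card A"
      have "ennreal (c (card A)) * (ennreal (1 / (card A * (card V - card A))) * emeasure M (H A))
        = ennreal (q (card A)) * emeasure M (H A)"
        using j A c by (subst mult.assoc[symmetric], subst ennreal_mult[symmetric]) (auto simp: q_def)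
      then show "ennreal (c (card A)) * (\<integral>\<^sup>+\<omega>. occupation r A \<omega> \<partial>M) = ennreal (q (card A)) * emeasure M (H A)"
        using A by (subst nn_integral_occupation) (auto simp: partial_balls_def H_def)
    qed
    also have "\<dots> = ennreal (q j) * (\<Sum>A\<in>{A \<in> partial_balls r. card A = j}. emeasure M (H A))"
      by (simp add: sum_distrib_left)
    also have "\<dots> \<le> ennreal (q j) * 1"
      unfolding H_def by (intro mult_left_mono sum_prob_surrounded[where j = j]) auto
    finally show "(\<Sum>A\<in>{A \<in> partial_balls r. card A = j}. ennreal (c (card A)) * (\<integral>\<^sup>+\<omega>. occupation r A \<omega> \<partial>M)) \<le> ennreal (q j)"
      by simp
  qed
  also have "\<dots> = ennreal (\<Sum>j = 1..<card V. q j)"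
    using q by (rule sum_ennreal)
  finally show ?thesis by (simp add: q_def)
qed

lemma nn_integral_max_dist:
  assumes r: "r \<in> V"
  shows "(\<integral>\<^sup>+\<omega>. ennreal (Max ((\<lambda>v. steiner_weight V (\<lambda>e. T e \<omega>) {r, v}) ` V)) \<partial>M)
    \<le> ennreal (\<Sum>j = 1..<card V. 1 / (real j * (real (card V) - real j)))"
proof -
  have "(\<integral>\<^sup>+\<omega>. ennreal (Max ((\<lambda>v. steiner_weight V (\<lambda>e. T e \<omega>) {r, v}) ` V)) \<partial>M)
      \<le> (\<integral>\<^sup>+\<omega>. (\<Sum>A\<in>partial_balls r. occupation r A \<omega>) \<partial>M)"
  proof (rule nn_integral_mono_AE)
    from AE_weights_nonneg show "AE \<omega> in M. ennreal (Max ((\<lambda>v. steiner_weight V (\<lambda>e. T e \<omega>) {r, v}) ` V))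
      \<le> (\<Sum>A\<in>partial_balls r. occupation r A \<omega>)"
    proof eventually_elim
      case (elim \<omega>)
      let ?d = "\<lambda>v. steiner_weight V (\<lambda>e. T e \<omega>) {r, v}"
      have "Max (?d ` V) \<in> ?d ` V" using r finite_vertices by (intro Max_in) auto
      then obtain v where v: "v \<in> V" "Max (?d ` V) = ?d v" by auto
      have "ennreal (Max (?d ` V)) \<le> (\<Sum>A\<in>partial_balls r. if v \<in> A then 0 else occupation r A \<omega>)"
        unfolding v(2) by (rule dist_le_occupation[OF r v(1) elim])
      also have "\<dots> \<le> (\<Sum>A\<in>partial_balls r. occupation r A \<omega>)" by (intro sum_mono) auto
      finally show ?case .
    qed
  qed
  also have "\<dots> = (\<Sum>A\<in>partial_balls r. ennreal 1 * (\<integral>\<^sup>+\<omega>. occupation r A \<omega> \<partial>M))"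
    by (subst nn_integral_sum) (auto intro!: occupation_measurable simp: partial_balls_def)
  also have "\<dots> \<le> ennreal (\<Sum>j = 1..<card V. 1 / (real j * (real (card V) - real j)))"
    by (rule sum_occupation[where c = "\<lambda>_. 1"]) simp
  finally show ?thesis .
qed

text \<open>A set of size \<open>j\<close> delays the n - j vertices outside it, which cancels one
  factor of the denominator and leaves a harmonic sum.\<close>

lemma nn_integral_sum_dist:
  assumes r: "r \<in> V"
  shows "(\<Sum>v\<in>V. \<integral>\<^sup>+\<omega>. ennreal (steiner_weight V (\<lambda>e. T e \<omega>) {r, v}) \<partial>M)
    \<le> ennreal (\<Sum>j = 1..<card V. 1 / real j)"
proof -
  have occ: "occupation r A \<in> borel_measurable M" if "A \<in> partial_balls r" for A
    using that by (intro occupation_measurable) (auto simp: partial_balls_def)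
  have "(\<Sum>v\<in>V. \<integral>\<^sup>+\<omega>. ennreal (steiner_weight V (\<lambda>e. T e \<omega>) {r, v}) \<partial>M)
    \<le> (\<Sum>v\<in>V. \<integral>\<^sup>+\<omega>. (\<Sum>A\<in>partial_balls r. if v \<in> A then 0 else occupation r A \<omega>) \<partial>M)"
  proof (intro sum_mono nn_integral_mono_AE)
    fix v assume "v \<in> V"
    from AE_weights_nonneg show "AE \<omega> in M. ennreal (steiner_weight V (\<lambda>e. T e \<omega>) {r, v})
      \<le> (\<Sum>A\<in>partial_balls r. if v \<in> A then 0 else occupation r A \<omega>)"
      by eventually_elim (rule dist_le_occupation[OF r \<open>v \<in> V\<close>])
  qed
  also have "\<dots> = (\<Sum>v\<in>V. \<Sum>A\<in>partial_balls r. if v \<in> A then 0 else (\<integral>\<^sup>+\<omega>. occupation r A \<omega> \<partial>M))"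
  proof (rule sum.cong[OF refl])
    fix v
    have "(\<lambda>\<omega>. if v \<in> A then 0 else occupation r A \<omega>) \<in> borel_measurable M" if "A \<in> partial_balls r" for A
      using occ[OF that] by (cases "v \<in> A") auto
    then show "(\<integral>\<^sup>+\<omega>. (\<Sum>A\<in>partial_balls r. if v \<in> A then 0 else occupation r A \<omega>) \<partial>M) =
      (\<Sum>A\<in>partial_balls r. if v \<in> A then 0 else (\<integral>\<^sup>+\<omega>. occupation r A \<omega> \<partial>M))"
      by (subst nn_integral_sum) (auto intro!: sum.cong)
  qed
  also have "\<dots> = (\<Sum>A\<in>partial_balls r. \<Sum>v\<in>V. if v \<in> A then 0 else (\<integral>\<^sup>+\<omega>. occupation r A \<omega> \<partial>M))"
    by (rule sum.swap)
  also have "\<dots> = (\<Sum>A\<in>partial_balls r. ennreal (card V - card A) * (\<integral>\<^sup>+\<omega>. occupation r A \<omega> \<partial>M))"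
  proof (rule sum.cong[OF refl])
    fix A assume "A \<in> partial_balls r"
    then have A: "A \<subseteq> V" by (auto simp: partial_balls_def)
    then have "card (V \<inter> - A) = card V - card A"
      using finite_vertices by (simp add: Diff_eq[symmetric] card_Diff_subset finite_subset)
    then show "(\<Sum>v\<in>V. if v \<in> A then 0 else (\<integral>\<^sup>+\<omega>. occupation r A \<omega> \<partial>M)) =
      ennreal (card V - card A) * (\<integral>\<^sup>+\<omega>. occupation r A \<omega> \<partial>M)"
      using finite_vertices card_mono[OF finite_vertices A]
      by (simp add: sum.If_cases Collect_neg_eq[symmetric] ennreal_of_nat_eq_real_of_nat of_nat_diff)
  qed
  \<comment> \<open>The absolute value only makes the weight nonnegative for every \<open>j\<close>,
    as \<open>sum_occupation\<close> asks; here \<open>card A\<close> is less than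
    \<open>card V\<close>.\<close>
  also have "\<dots> = (\<Sum>A\<in>partial_balls r. ennreal \<bar>real (card V) - real (card A)\<bar> * (\<integral>\<^sup>+\<omega>. occupation r A \<omega> \<partial>M))"
    by (intro sum.cong refl) (auto simp: partial_balls_def dest!: psubset_card_mono[OF finite_vertices])
  also have "\<dots> \<le> ennreal (\<Sum>j = 1..<card V. \<bar>real (card V) - real j\<bar> / (real j * (real (card V) - real j)))"
    by (rule sum_occupation[where c = "\<lambda>j. \<bar>real (card V) - real j\<bar>"]) simp
  also have "(\<Sum>j = 1..<card V. \<bar>real (card V) - real j\<bar> / (real j * (real (card V) - real j))) = (\<Sum>j = 1..<card V. 1 / real j)"
    by (intro sum.cong refl) auto
  finally show ?thesis .
qed

text \<open>Swapping the vertices \<open>j\<close> and \<open>v\<close> permutes the edges, fixes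
  \<open>r\<close>, and preserves the product law of the weights.\<close>

lemma nn_integral_dist_exchange:
  assumes j: "r \<in> V" "j \<in> V" "v \<in> V" "j \<noteq> r" "v \<noteq> r"
  shows "(\<integral>\<^sup>+\<omega>. ennreal (steiner_weight V (\<lambda>e. T e \<omega>) {r, j}) \<partial>M)
    \<le> (\<integral>\<^sup>+\<omega>. ennreal (steiner_weight V (\<lambda>e. T e \<omega>) {r, v}) \<partial>M)"
proof -
  define p where "p x = (if x = j then v else if x = v then j else x)" for x
  let ?E = "complete_edges V"
  define f where "f w = ennreal (steiner_weight V w {r, v})" for w
  have pp: "p (p x) = x" for x by (auto simp: p_def)
  have pV: "p ` V = V"
  proof
    show "p ` V \<subseteq> V" using j by (auto simp: p_def)
    then show "V \<subseteq> p ` V" using pp by (metis image_eqI image_subset_iff subsetI)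
  qed
  have bij: "bij_betw p V V"
    using pV by (auto simp: bij_betw_def intro: inj_on_inverseI[of V p p] simp: pp)
  have ppe: "p ` p ` e = e" for e by (auto simp: pp image_image)
  have pE: "p ` e \<in> ?E" if "e \<in> ?E" for e
    using that pV card_image[of p e] inj_on_inverseI[of e p p] by (auto simp: complete_edges_def pp)
  have "{r, j} \<in> ?E" using j by (simp add: pair_in_complete_edges)
  then have E_ne: "?E \<noteq> {}" by blast
  have f: "f \<in> borel_measurable (\<Pi>\<^sub>M e\<in>?E. borel)"
    unfolding f_def[abs_def]
    by (intro measurable_compose[OF _ measurable_ennreal] borel_measurable_steiner_weight finite_vertices)
      auto
  have img: "p ` {r, v} = {r, j}" using j by (auto simp: p_def)
  have "(\<integral>\<^sup>+\<omega>. ennreal (steiner_weight V (\<lambda>e. T e \<omega>) {r, j}) \<partial>M) \<le>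
      (\<integral>\<^sup>+\<omega>. f (\<lambda>e\<in>?E. (\<lambda>e\<in>?E. T e \<omega>) (p ` e)) \<partial>M)"
  proof (intro nn_integral_mono)
    fix \<omega>
    have "steiner_weight V (\<lambda>e. T e \<omega>) (p ` {r, v}) \<le> steiner_weight V (\<lambda>e. T (p ` e) \<omega>) {r, v}"
      using j by (intro steiner_weight_image_le finite_vertices bij) auto
    also have "\<dots> = steiner_weight V (\<lambda>e\<in>?E. (\<lambda>e\<in>?E. T e \<omega>) (p ` e)) {r, v}"
      by (rule steiner_weight_cong) (simp add: pE)
    finally show "ennreal (steiner_weight V (\<lambda>e. T e \<omega>) {r, j}) \<le> f (\<lambda>e\<in>?E. (\<lambda>e\<in>?E. T e \<omega>) (p ` e))"
      unfolding f_def img by (rule ennreal_leI)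
  qed
  also have "\<dots> = (\<integral>\<^sup>+x. f (\<lambda>e\<in>?E. x (p ` e)) \<partial>(\<Pi>\<^sub>M e\<in>?E. unit_exponential))"
  proof (rule nn_integral_weights[OF subset_refl E_ne])
    show "(\<lambda>x. f (\<lambda>e\<in>?E. x (p ` e))) \<in> borel_measurable (\<Pi>\<^sub>M e\<in>?E. borel)"
      by (intro measurable_compose[OF _ f] measurable_restrict measurable_component_singleton pE)
  qed
  also have "\<dots> = (\<integral>\<^sup>+x. f x \<partial>distr (\<Pi>\<^sub>M e\<in>?E. unit_exponential) (\<Pi>\<^sub>M e\<in>?E. unit_exponential) (\<lambda>x. \<lambda>e\<in>?E. x (p ` e)))"
  proof (rule nn_integral_distr[symmetric])
    show "(\<lambda>x. \<lambda>e\<in>?E. x (p ` e)) \<in> (\<Pi>\<^sub>M e\<in>?E. unit_exponential) \<rightarrow>\<^sub>M (\<Pi>\<^sub>M e\<in>?E. unit_exponential)"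
      by (intro measurable_restrict measurable_component_singleton pE)
    have "sets (\<Pi>\<^sub>M e\<in>?E. unit_exponential) = sets (\<Pi>\<^sub>M e\<in>?E. borel)"
      by (rule sets_PiM_cong) auto
    from f[folded measurable_cong_sets[OF this refl]] show "f \<in> borel_measurable (distr (\<Pi>\<^sub>M e\<in>?E. unit_exponential) (\<Pi>\<^sub>M e\<in>?E. unit_exponential) (\<lambda>x. \<lambda>e\<in>?E. x (p ` e)))"
      by (simp only: measurable_distr_eq1)
  qed
  also have "distr (\<Pi>\<^sub>M e\<in>?E. unit_exponential) (\<Pi>\<^sub>M e\<in>?E. unit_exponential) (\<lambda>x. \<lambda>e\<in>?E. x (p ` e))
      = (\<Pi>\<^sub>M e\<in>?E. unit_exponential)"
  proof (intro distr_PiM_reindex prob_space_unit_exponential)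
    show "inj_on ((`) p) ?E" by (rule inj_on_inverseI[where g = "(`) p"]) (simp add: ppe)
  qed (use pE in auto)
  also have "(\<integral>\<^sup>+x. f x \<partial>(\<Pi>\<^sub>M e\<in>?E. unit_exponential)) = (\<integral>\<^sup>+\<omega>. f (\<lambda>e\<in>?E. T e \<omega>) \<partial>M)"
    by (rule nn_integral_weights[OF subset_refl E_ne f, symmetric])
  also have "\<dots> = (\<integral>\<^sup>+\<omega>. ennreal (steiner_weight V (\<lambda>e. T e \<omega>) {r, v}) \<partial>M)"
    unfolding f_def by (intro nn_integral_cong arg_cong[where f = ennreal] steiner_weight_cong) auto
  finally show ?thesis .
qed

text \<open>By exchange the mean distance to \<open>j\<close> is at most that to any other vertex,
  hence at most the average over the \<open>card V - 1\<close> vertices different from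
  \<open>r\<close>.\<close>

lemma nn_integral_dist:
  assumes j: "r \<in> V" "j \<in> V" "j \<noteq> r"
  shows "(\<integral>\<^sup>+\<omega>. ennreal (steiner_weight V (\<lambda>e. T e \<omega>) {r, j}) \<partial>M)
    \<le> ennreal ((\<Sum>j = 1..<card V. 1 / real j) / (real (card V) - 1))"
proof -
  let ?d = "\<lambda>v. \<integral>\<^sup>+\<omega>. ennreal (steiner_weight V (\<lambda>e. T e \<omega>) {r, v}) \<partial>M"
  have c: "card (V - {r}) = card V - 1" using j finite_vertices by simp
  have pos: "card V - 1 > 0" using j finite_vertices c
    by (metis Diff_iff card_gt_0_iff empty_iff finite_Diff singletonD)
  have "ennreal (real (card V) - 1) * ?d j = (\<Sum>v\<in>V - {r}. ?d j)"
    using pos by (simp add: c ennreal_of_nat_eq_real_of_nat of_nat_diff)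
  also have "\<dots> \<le> (\<Sum>v\<in>V - {r}. ?d v)" using j by (intro sum_mono nn_integral_dist_exchange) auto
  also have "\<dots> \<le> (\<Sum>v\<in>V. ?d v)" using finite_vertices by (intro sum_mono2) auto
  also have "\<dots> \<le> ennreal (\<Sum>j = 1..<card V. 1 / real j)" by (rule nn_integral_sum_dist[OF j(1)])
  finally have le: "ennreal (real (card V) - 1) * ?d j \<le> ennreal (\<Sum>j = 1..<card V. 1 / real j)" .
  have "?d j = ennreal (1 / (real (card V) - 1)) * (ennreal (real (card V) - 1) * ?d j)"
    using pos by (subst mult.assoc[symmetric], subst ennreal_mult[symmetric]) auto
  also have "\<dots> \<le> ennreal (1 / (real (card V) - 1)) * ennreal (\<Sum>j = 1..<card V. 1 / real j)"
    using le by (rule mult_left_mono) simp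
  also have "\<dots> = ennreal ((\<Sum>j = 1..<card V. 1 / real j) / (real (card V) - 1))"
    using pos by (subst ennreal_mult[symmetric]) (auto intro: sum_nonneg)
  finally show ?thesis .
qed

end

section \<open>Convergence\<close>

lemma sum_inverse_le_ln:
  assumes "n \<ge> 1"
  shows "(\<Sum>j = 1..<n. 1 / real j) \<le> ln (real n) + 1"
proof -
  have "(\<Sum>j = 1..<n. 1 / real j) \<le> (\<Sum>j = 1..n. 1 / real j)" by (intro sum_mono2) auto
  also have "\<dots> = harm n" by (simp add: harm_def inverse_eq_divide)
  also have "harm n - ln (real n) \<le> harm 1 - ln (real 1)"
    using assms by (intro euler_mascheroni_sequence_decreasing) auto
  then have "harm n \<le> ln (real n) + 1" by (simp add: harm_def)
  finally show ?thesis .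
qed

text \<open>Partial fractions, and the reflection of \<open>j\<close> into n - j. This doubling is
  why a free terminal counts twice in the constant.\<close>

lemma sum_inverse_prod:
  "(\<Sum>j = 1..<n. 1 / (real j * (real n - real j))) = 2 * (\<Sum>j = 1..<n. 1 / real j) / real n"
proof -
  have "(\<Sum>j = 1..<n. 1 / (real j * (real n - real j))) = (\<Sum>j = 1..<n. 1 / real j / real n + 1 / (real n - real j) / real n)"
    by (intro sum.cong refl) (auto simp: field_simps)
  also have "\<dots> = (\<Sum>j = 1..<n. 1 / real j) / real n + (\<Sum>j = 1..<n. 1 / (real n - real j)) / real n"
    by (simp add: sum.distrib sum_divide_distrib)
  also have "(\<Sum>j = 1..<n. 1 / (real n - real j)) = (\<Sum>j = 1..<n. 1 / real j)"
    by (rule sum.reindex_bij_witness[of _ "\<lambda>j. n - j" "\<lambda>j. n - j"]) (auto simp: of_nat_diff)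
  finally show ?thesis by simp
qed

text \<open>Ratio test: the quotients tend to 1/q and so are eventually below 1/\<rho> for a \<rho>
  strictly between 1 and \<open>q\<close>. The sum bounds the first moment estimate uniformly in
  \<open>n\<close>.\<close>

lemma summable_poly_geometric:
  fixes q :: real
  assumes "q > 1"
  shows "summable (\<lambda>e. (1 / q) ^ e * real (e + 1) ^ p)"
proof -
  define \<rho> where "\<rho> = (1 + q) / 2"
  have \<rho>: "1 < \<rho>" "\<rho> < q" using assms by (auto simp: \<rho>_def)
  have "(\<lambda>e. (real (e + 2) / real (e + 1)) ^ p) \<longlonglongrightarrow> 1 ^ p"
    by (intro tendsto_power) real_asymp
  then have "\<forall>\<^sub>F e in sequentially. (real (e + 2) / real (e + 1)) ^ p < q / \<rho>"
    using \<rho> by (intro order_tendstoD(2)) auto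
  then obtain N where N: "(real (e + 2) / real (e + 1)) ^ p < q / \<rho>" if "e \<ge> N" for e
    by (auto simp: eventually_sequentially)
  show ?thesis
  proof (rule summable_ratio_test)
    show "1 / \<rho> < 1" using \<rho> by simp
    fix e assume "e \<ge> N"
    have "real (e + 2) ^ p = (real (e + 2) / real (e + 1)) ^ p * real (e + 1) ^ p"
      by (simp add: power_divide)
    also have "\<dots> \<le> q / \<rho> * real (e + 1) ^ p" using N[OF \<open>e \<ge> N\<close>] by (intro mult_right_mono) auto
    finally have le: "real (e + 2) ^ p \<le> q / \<rho> * real (e + 1) ^ p" .
    have "(1 / q) ^ Suc e * real (e + 2) ^ p \<le> (1 / q) ^ Suc e * (q / \<rho> * real (e + 1) ^ p)"
      using assms by (intro mult_left_mono le) auto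
    also have "\<dots> = 1 / \<rho> * ((1 / q) ^ e * real (e + 1) ^ p)" using assms by simp
    finally show "norm ((1 / q) ^ Suc e * real (Suc e + 1) ^ p) \<le> 1 / \<rho> * norm ((1 / q) ^ e * real (e + 1) ^ p)"
      using assms by simp
  qed
qed

text \<open>Since \<open>X n\<close> is almost never much below \<open>c\<close>, exceeding c +
  \<epsilon> with a probability bounded away from 0 would push the mean above the limit of
  \<open>u\<close>.\<close>

lemma converges_in_prob_one_sided:
  fixes c :: real
  assumes ps: "\<forall>\<^sub>F n in sequentially. prob_space (M n)"
    and meas: "\<forall>\<^sub>F n in sequentially. X n \<in> borel_measurable (M n)"
    and nonneg: "\<forall>\<^sub>F n in sequentially. AE \<omega> in M n. X n \<omega> \<ge> 0"
    and mean: "\<forall>\<^sub>F n in sequentially. (\<integral>\<^sup>+\<omega>. ennreal (X n \<omega>) \<partial>M n) \<le> ennreal (u n)"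
    and u: "u \<longlonglongrightarrow> c" and c: "c > 0"
    and lower: "\<And>\<theta>. 0 < \<theta> \<Longrightarrow> \<theta> < 1 \<Longrightarrow>
      (\<lambda>n. measure (M n) {\<omega> \<in> space (M n). X n \<omega> \<le> (1 - \<theta>) * c}) \<longlonglongrightarrow> 0"
  shows "converges_in_prob M X c"
  unfolding converges_in_prob_def
proof (intro conjI allI impI meas)
  fix \<epsilon> :: real assume \<epsilon>: "\<epsilon> > 0"
  show "(\<lambda>n. measure (M n) {\<omega> \<in> space (M n). \<epsilon> < \<bar>X n \<omega> - c\<bar>}) \<longlonglongrightarrow> 0"
  proof (rule LIMSEQ_I)
    fix \<eta> :: real assume \<eta>: "\<eta> > 0"
    \<comment> \<open>The first bound gives \<theta> < 1, the second puts (1 - \<theta>) c above c -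
      \<epsilon>, and the third makes the limit \<theta> c / (\<epsilon> + \<theta> c) of
      \<open>b\<close> at most \<eta>/2.\<close>
    define \<theta> where "\<theta> = min (1 / 2) (min (\<epsilon> / c) (\<epsilon> * \<eta> / (2 * c)))"
    have \<theta>: "0 < \<theta>" "\<theta> < 1" using \<epsilon> \<eta> c by (auto simp: \<theta>_def)
    have \<theta>c: "\<theta> * c \<le> \<epsilon>" "\<theta> * c \<le> \<epsilon> * (\<eta> / 2)"
    proof -
      have "\<theta> \<le> \<epsilon> / c" "\<theta> \<le> \<epsilon> * \<eta> / (2 * c)" by (auto simp: \<theta>_def)
      then show "\<theta> * c \<le> \<epsilon>" "\<theta> * c \<le> \<epsilon> * (\<eta> / 2)" using c by (auto simp: field_simps)
    qed
    define lo where "lo n = measure (M n) {\<omega> \<in> space (M n). X n \<omega> \<le> (1 - \<theta>) * c}" for n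
    \<comment> \<open>Off the low event \<open>X n\<close> is at least (1 - \<theta>) c, and above c
      + \<epsilon> it gains a further \<epsilon> + \<theta> c; comparing with the mean bound
      \<open>u n\<close> and solving for the upper tail gives the quotient.\<close>
    define b where "b n = lo n + (u n - (1 - \<theta>) * c * (1 - lo n)) / (\<epsilon> + \<theta> * c)" for n
    have lo: "lo \<longlonglongrightarrow> 0" unfolding lo_def by (rule lower[OF \<theta>])
    have "b \<longlonglongrightarrow> 0 + (c - (1 - \<theta>) * c * (1 - 0)) / (\<epsilon> + \<theta> * c)"
      unfolding b_def using \<epsilon> \<theta> c
      by (intro tendsto_intros lo u) (metis add_pos_pos mult_pos_pos less_irrefl)
    moreover have "0 + (c - (1 - \<theta>) * c * (1 - 0)) / (\<epsilon> + \<theta> * c) < \<eta>"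
    proof -
      have "\<theta> * c / (\<epsilon> + \<theta> * c) \<le> \<theta> * c / \<epsilon>"
        using \<epsilon> \<theta> c by (intro divide_left_mono) (auto simp: add_pos_pos)
      also have "\<dots> \<le> \<eta> / 2" using \<theta>c(2) \<epsilon> by (simp add: field_simps)
      finally have "\<theta> * c / (\<epsilon> + \<theta> * c) < \<eta>" using \<eta> by linarith
      moreover have "0 + (c - (1 - \<theta>) * c * (1 - 0)) = \<theta> * c" by (simp add: algebra_simps)
      ultimately show ?thesis by simp
    qed
    ultimately have "\<forall>\<^sub>F n in sequentially. b n < \<eta>" by (rule order_tendstoD)
    then have "\<forall>\<^sub>F n in sequentially. norm (measure (M n) {\<omega> \<in> space (M n). \<epsilon> < \<bar>X n \<omega> - c\<bar>} - 0) < \<eta>"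
      using ps meas nonneg mean order_tendstoD(1)[OF u c]
    proof eventually_elim
      case (elim n)
      interpret prob_space "M n" by fact
      note [measurable] = elim(3)
      define A where "A = {\<omega> \<in> space (M n). X n \<omega> \<le> (1 - \<theta>) * c}"
      define B where "B = {\<omega> \<in> space (M n). X n \<omega> > c + \<epsilon>}"
      have [measurable]: "A \<in> events" "B \<in> events" unfolding A_def B_def by measurable
      have lo_eq: "lo n = prob A" by (simp add: lo_def A_def)
      have c1: "(1 - \<theta>) * c \<ge> 0" using \<theta> c by simp
      have c2: "\<epsilon> + \<theta> * c > 0" using \<theta> \<epsilon> c by (simp add: add_pos_pos)
      have "ennreal ((1 - \<theta>) * c * (1 - lo n) + (\<epsilon> + \<theta> * c) * prob B) =
          ennreal ((1 - \<theta>) * c) * emeasure (M n) (space (M n) - A) + ennreal (\<epsilon> + \<theta> * c) * emeasure (M n) B"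
        using c1 c2 by (simp add: emeasure_eq_measure prob_compl lo_eq ennreal_mult[symmetric] ennreal_plus[symmetric] del: ennreal_plus)
      also have "\<dots> = (\<integral>\<^sup>+\<omega>. ennreal ((1 - \<theta>) * c) * indicator (space (M n) - A) \<omega> + ennreal (\<epsilon> + \<theta> * c) * indicator B \<omega> \<partial>M n)"
        by (subst nn_integral_add) (auto simp: nn_integral_cmult_indicator)
      also have "\<dots> \<le> (\<integral>\<^sup>+\<omega>. ennreal (X n \<omega>) \<partial>M n)"
      proof (rule nn_integral_mono_AE)
        from elim(4) show "AE \<omega> in M n. ennreal ((1 - \<theta>) * c) * indicator (space (M n) - A) \<omega>
          + ennreal (\<epsilon> + \<theta> * c) * indicator B \<omega> \<le> ennreal (X n \<omega>)"
        proof (rule AE_mp, intro AE_I2 impI)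
          fix \<omega> assume \<omega>: "\<omega> \<in> space (M n)" "0 \<le> X n \<omega>"
          consider "\<omega> \<in> A" | "\<omega> \<notin> A" "\<omega> \<notin> B" | "\<omega> \<notin> A" "\<omega> \<in> B" by blast
          then show "ennreal ((1 - \<theta>) * c) * indicator (space (M n) - A) \<omega>
            + ennreal (\<epsilon> + \<theta> * c) * indicator B \<omega> \<le> ennreal (X n \<omega>)"
          proof cases
            case 1
            have "\<theta> * c \<ge> 0" using \<theta> c by simp
            then have "\<omega> \<notin> B" using 1 \<epsilon> c by (auto simp: A_def B_def algebra_simps)
            then show ?thesis using 1 by simp
          next
            case 2
            then show ?thesis using \<omega> by (auto simp: A_def intro!: ennreal_leI)
          next
            case 3
            then have "ennreal ((1 - \<theta>) * c) + ennreal (\<epsilon> + \<theta> * c) \<le> ennreal (X n \<omega>)"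
              using c1 c2 by (subst ennreal_plus[symmetric]) (auto simp: B_def algebra_simps intro!: ennreal_leI)
            then show ?thesis using 3 \<omega> by simp
          qed
        qed
      qed
      also have "\<dots> \<le> ennreal (u n)" by fact
      finally have "(1 - \<theta>) * c * (1 - lo n) + (\<epsilon> + \<theta> * c) * prob B \<le> u n"
        using elim(6) by (subst (asm) ennreal_le_iff) auto
      then have PB: "prob B \<le> (u n - (1 - \<theta>) * c * (1 - lo n)) / (\<epsilon> + \<theta> * c)"
        using c2 by (simp add: field_simps)
      have "prob {\<omega> \<in> space (M n). \<epsilon> < \<bar>X n \<omega> - c\<bar>} \<le> prob (A \<union> B)"
        using \<theta>c(1) by (intro finite_measure_mono) (auto simp: A_def B_def algebra_simps abs_if split: if_splits)
      also have "\<dots> \<le> prob A + prob B" by (rule measure_Un_le) simp_all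
      also have "\<dots> \<le> b n" using PB by (simp add: b_def lo_eq)
      finally show ?case using elim(1) by simp
    qed
    then show "\<exists>N. \<forall>n\<ge>N. norm (measure (M n) {\<omega> \<in> space (M n). \<epsilon> < \<bar>X n \<omega> - c\<bar>} - 0) < \<eta>"
      by (simp add: eventually_sequentially)
  qed
qed

section \<open>The maximum over terminal sets: tail bound, mean bound, conclusion\<close>

definition terminal_sets :: "nat \<Rightarrow> nat \<Rightarrow> nat \<Rightarrow> nat set set" where
  "terminal_sets k l n = {S. S \<subseteq> {1..n} \<and> {1..k} \<subseteq> S \<and> card S = k + l}"

lemma max_steiner_weight_eq:
  "max_steiner_weight k l n w = Max (steiner_weight {1..n} w ` terminal_sets k l n)"
  by (simp add: max_steiner_weight_def terminal_sets_def)

lemma finite_terminal_sets: "finite (terminal_sets k l n)"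
  by (rule finite_subset[of _ "Pow {1..n}"]) (auto simp: terminal_sets_def)

lemma terminal_sets_nonempty: "n \<ge> k + l \<Longrightarrow> terminal_sets k l n \<noteq> {}"
  by (auto simp: terminal_sets_def intro!: exI[of _ "{1..k + l}"])

lemma terminal_setsE:
  assumes "S \<in> terminal_sets k l n" "k > 0"
  obtains Q where "S = insert 1 ({2..k} \<union> Q)" "Q \<subseteq> {1..n} - insert 1 {2..k}" "card Q = l"
proof
  have S: "S \<subseteq> {1..n}" "{1..k} \<subseteq> S" "card S = k + l" using assms by (auto simp: terminal_sets_def)
  have ins: "insert 1 {2..k} = {1..k}" using assms(2) by auto
  show "S = insert 1 ({2..k} \<union> (S - {1..k}))" using S(2) ins by auto
  show "S - {1..k} \<subseteq> {1..n} - insert 1 {2..k}" using S ins by auto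
  show "card (S - {1..k}) = l" using S by (simp add: card_Diff_subset)
qed

lemma terminal_setsI:
  assumes "Q \<subseteq> {1..n} - insert 1 {2..k}" "card Q = l" "k > 0" "n \<ge> k"
  shows "insert 1 ({2..k} \<union> Q) \<in> terminal_sets k l n"
proof -
  have ins: "insert 1 {2..k} = {1..k}" using assms(3) by auto
  have "insert 1 ({2..k} \<union> Q) = {1..k} \<union> Q" using ins by auto
  moreover have "card ({1..k} \<union> Q) = k + l"
  proof (subst card_Un_disjoint)
    show "finite Q" using assms(1) finite_subset by blast
    show "{1..k} \<inter> Q = {}" using assms(1) ins by auto
  qed (use assms in auto)
  ultimately show ?thesis using assms ins by (auto simp: terminal_sets_def)
qed

text \<open>With vertex 1 as root there are k - 1 + l further terminals. The threshold splits into
  (1 - \<theta>) (k - 1 + l) ln n / n for the tree and \<open>a\<close> for each of the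
  \<open>l\<close> special terminals, which explains the constant k + 2l - 1.\<close>

lemma prob_max_steiner_weight_le:
  fixes k l n :: nat and \<theta> C a m :: real
  assumes ew: "exponential_weights M {1..n} T" and k: "k > 0" and l: "l > 0" and n: "n \<ge> k + l"
    and \<theta>: "0 < \<theta>" "\<theta> < 1"
    and C: "\<And>N. (\<Sum>e<N. (1 / (1 + \<theta>)) ^ e * real (e + 1) ^ (4 * (k - 1 + l))) \<le> C"
  defines "a \<equiv> (1 - \<theta>) * ln n / n"
  defines "m \<equiv> (real n - real k) * exp (- a * (real n - 1))"
  assumes m: "m \<ge> 2 * real l"
  shows "measure M {\<omega> \<in> space M. max_steiner_weight k l n (\<lambda>e. T e \<omega>) \<le> (1 - \<theta>) * (real k + 2 * real l - 1) * (ln n / n)}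
    \<le> 4 / m + 4 * (exp (2 * a) - 1) + C * exp (- \<theta>\<^sup>2 * real (k - 1 + l) * ln n) * (2 * real l) ^ l * exp (a * real l ^ 2)"
proof -
  interpret exponential_weights M "{1..n}" T by fact
  define i where "i = k - 1 + l"
  define t where "t = (1 - \<theta>) * real i * (ln n / n)"
  define W where "W = {1..n} - insert 1 {2..k}"
  define c where "c = t + a * l"
  have n1: "n \<ge> 1" "1 \<in> {1..n}" using n k by auto
  have a: "a \<ge> 0" using \<theta> n1 by (simp add: a_def)
  have t: "t \<ge> 0" using \<theta> n1 by (simp add: t_def)
  have C0: "C \<ge> 0" using C[of 0] by simp
  have c_eq: "(1 - \<theta>) * (real k + 2 * real l - 1) * (ln n / n) = c"
  proof -
    have "c = (1 - \<theta>) * (real i + real l) * (ln n / n)"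
      by (simp add: c_def t_def a_def algebra_simps add_divide_distrib diff_divide_distrib)
    moreover have "real i + real l = real k + 2 * real l - 1" using k by (simp add: i_def of_nat_diff)
    ultimately show ?thesis by simp
  qed
  have B: "{2..k} \<subseteq> {1..n} - {1}" using n by auto
  have ins: "insert 1 {2..k} = {1..k}" using k by auto
  have cW: "real (card W) = real n - real k"
    using n unfolding W_def ins by (simp add: card_Diff_subset of_nat_diff)
  have event: "{\<omega> \<in> space M. max_steiner_weight k l n (\<lambda>e. T e \<omega>) \<le> c} =
    {\<omega> \<in> space M. \<forall>Q\<subseteq>W. card Q = l \<longrightarrow> steiner_weight {1..n} (\<lambda>e. T e \<omega>) (insert 1 ({2..k} \<union> Q)) \<le> c}"
  proof -
    have "max_steiner_weight k l n w \<le> c \<longleftrightarrow>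
      (\<forall>Q\<subseteq>W. card Q = l \<longrightarrow> steiner_weight {1..n} w (insert 1 ({2..k} \<union> Q)) \<le> c)" for w
    proof -
      have "max_steiner_weight k l n w \<le> c \<longleftrightarrow> (\<forall>S\<in>terminal_sets k l n. steiner_weight {1..n} w S \<le> c)"
        unfolding max_steiner_weight_eq using terminal_sets_nonempty[OF n]
        by (subst Max_le_iff) (auto intro: finite_terminal_sets)
      also have "\<dots> \<longleftrightarrow> (\<forall>Q\<subseteq>W. card Q = l \<longrightarrow> steiner_weight {1..n} w (insert 1 ({2..k} \<union> Q)) \<le> c)"
        unfolding W_def using terminal_setsE[of _ k l n] terminal_setsI[of _ n k l] k n
        by (metis add_leD1)
      finally show ?thesis .
    qed
    then show ?thesis by simp
  qed
  have "prob {\<omega> \<in> space M. \<forall>Q\<subseteq>W. card Q = l \<longrightarrow> steiner_weight {1..n} (\<lambda>e. T e \<omega>) (insert 1 ({2..k} \<union> Q)) \<le> c}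
    \<le> 4 / (card W * exp (- a * (real (card {1..n}) - 1))) + 4 * (exp (2 * a) - 1)
      + C * exp (- \<theta>\<^sup>2 * i * ln n) * (2 * real l) ^ l * exp (a * real l ^ 2)"
    unfolding W_def
  proof (rule prob_all_light)
    show "2 * real l \<le> card ({1..n} - insert 1 {2..k}) * exp (- a * (real (card {1..n}) - 1))"
      using m cW by (simp add: m_def W_def)
    fix Q assume Q: "Q \<subseteq> {1..n} - insert 1 {2..k}" "card Q = l"
    have cR: "card ({2..k} \<union> Q) = i"
      using Q finite_subset[OF Q(1)] k by (subst card_Un_disjoint) (auto simp: i_def)
    \<comment> \<open>The Chernoff parameter: 1 + \<kappa> = n (1 + \<theta>) reduces the sum over
      trees to the one bounded by \<open>C\<close>. Combined with \<open>t\<close> it yields n^((1 -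
      \<theta>^2) i), while the \<open>i\<close> prescribed terminals save n^i.\<close>
    define \<kappa> where "\<kappa> = n * (1 + \<theta>) - 1"
    have \<kappa>: "\<kappa> \<ge> 0"
    proof -
      have "1 * 1 \<le> real n * (1 + \<theta>)" using n1 \<theta> by (intro mult_mono) auto
      then show ?thesis by (simp add: \<kappa>_def)
    qed
    have "prob {\<omega> \<in> heavy (incident Q) a. steiner_weight {1..n} (\<lambda>e. T e \<omega>) (insert 1 ({2..k} \<union> Q)) \<le> t + a * card Q}
      \<le> exp (\<kappa> * t) / real (card {1..n}) ^ card ({2..k} \<union> Q) *
       (\<Sum>e<card {1..n}. (card {1..n} / (1 + \<kappa>)) ^ e * real (e + 1) ^ (4 * card ({2..k} \<union> Q))) * exp (- a * card (incident Q))"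
      using Q B n1(2) by (intro prob_heavy_light a \<kappa>) auto
    also have "\<dots> = exp (\<kappa> * t) / real n ^ i * (\<Sum>e<n. (1 / (1 + \<theta>)) ^ e * real (e + 1) ^ (4 * i)) * exp (- a * card (incident Q))"
      using n1 by (simp add: cR \<kappa>_def)
    also have "\<dots> \<le> exp (- \<theta>\<^sup>2 * i * ln n) * C * exp (- a * card (incident Q))"
    proof (intro mult_right_mono mult_mono)
      have "exp (\<kappa> * t) \<le> exp (n * (1 + \<theta>) * t)" using t by (auto simp: \<kappa>_def intro!: mult_right_mono)
      also have "n * (1 + \<theta>) * t = - \<theta>\<^sup>2 * i * ln n + i * ln n"
        using n1 by (simp add: t_def power2_eq_square field_simps)
      also have "exp (- \<theta>\<^sup>2 * i * ln n + i * ln n) = exp (- \<theta>\<^sup>2 * i * ln n) * real n ^ i"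
        using n1 by (simp only: exp_add exp_of_nat_mult) simp
      finally show "exp (\<kappa> * t) / real n ^ i \<le> exp (- \<theta>\<^sup>2 * i * ln n)"
        using n1 by (simp add: field_simps)
      show "(\<Sum>e<n. (1 / (1 + \<theta>)) ^ e * real (e + 1) ^ (4 * i)) \<le> C" unfolding i_def by (rule C)
    qed (use \<theta> in \<open>auto intro!: sum_nonneg\<close>)
    finally show "prob {\<omega> \<in> heavy (incident Q) a. steiner_weight {1..n} (\<lambda>e. T e \<omega>) (insert 1 ({2..k} \<union> Q)) \<le> c}
      \<le> C * exp (- \<theta>\<^sup>2 * i * ln n) * exp (- a * card (incident Q))"
      by (simp add: c_def Q(2) mult_ac)
  qed (use n1 B a l n C0 in auto)
  then show ?thesis unfolding c_eq event cW by (simp add: m_def i_def)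
qed

text \<open>The maximising free terminals depend on the weights, so only the largest distance
  controls them; the prescribed terminals keep their own distances, whose means are half as large to
  leading order.\<close>

lemma AE_max_steiner_weight_le:
  fixes k l n :: nat and d :: "'a \<Rightarrow> nat \<Rightarrow> real"
  assumes ew: "exponential_weights M {1..n} T" and k: "k > 0" and n: "n \<ge> k + l"
  defines "d \<equiv> \<lambda>\<omega> v. steiner_weight {1..n} (\<lambda>e. T e \<omega>) {1, v}"
  shows "AE \<omega> in M. 0 \<le> max_steiner_weight k l n (\<lambda>e. T e \<omega>) \<and>
    max_steiner_weight k l n (\<lambda>e. T e \<omega>) \<le> (\<Sum>v = 2..k. d \<omega> v) + l * Max (d \<omega> ` {1..n}) \<and>
    (\<forall>v\<in>{1..n}. 0 \<le> d \<omega> v)"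
proof -
  interpret exponential_weights M "{1..n}" T by fact
  have n1: "1 \<in> {1..n}" using n k by auto
  from AE_weights_nonneg show ?thesis
  proof eventually_elim
    case (elim \<omega>)
    let ?w = "\<lambda>e. T e \<omega>"
    let ?S = "steiner_weight {1..n} ?w"
    have "max_steiner_weight k l n ?w \<in> ?S ` terminal_sets k l n"
      unfolding max_steiner_weight_eq using terminal_sets_nonempty[OF n] finite_terminal_sets
      by (intro Max_in) auto
    then obtain S where S: "S \<in> terminal_sets k l n" "max_steiner_weight k l n ?w = ?S S" by auto
    from terminal_setsE[OF S(1) k] obtain Q where
      Q: "S = insert 1 ({2..k} \<union> Q)" "Q \<subseteq> {1..n} - insert 1 {2..k}" "card Q = l" by blast
    have nonneg: "0 \<le> ?S A" if "A \<subseteq> {1..n}" for A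
      using that n1 elim by (intro steiner_weight_nonneg) auto
    have d: "0 \<le> d \<omega> v" if "v \<in> {1..n}" for v
      unfolding d_def using that n1 by (intro nonneg) auto
    have "?S S \<le> (\<Sum>v\<in>{2..k} \<union> Q. d \<omega> v)"
      unfolding Q(1) d_def using Q(2) n n1 elim by (intro steiner_weight_le_sum_dist) auto
    also have "\<dots> = (\<Sum>v = 2..k. d \<omega> v) + (\<Sum>v\<in>Q. d \<omega> v)"
      using Q(2) finite_subset[OF Q(2)] by (intro sum.union_disjoint) auto
    also have "(\<Sum>v\<in>Q. d \<omega> v) \<le> (\<Sum>v\<in>Q. Max (d \<omega> ` {1..n}))"
      using Q(2) by (intro sum_mono Max_ge) auto
    finally have "?S S \<le> (\<Sum>v = 2..k. d \<omega> v) + l * Max (d \<omega> ` {1..n})" using Q(3) by simp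
    moreover have "S \<subseteq> {1..n}" using S(1) by (auto simp: terminal_sets_def)
    ultimately show ?case using nonneg d by (simp add: S(2))
  qed
qed

lemma nn_integral_max_steiner_weight:
  fixes k l n :: nat
  assumes ew: "exponential_weights M {1..n} T" and k: "k > 0" and n: "n \<ge> k + l" "n \<ge> 2"
  shows "(\<integral>\<^sup>+\<omega>. ennreal (max_steiner_weight k l n (\<lambda>e. T e \<omega>)) \<partial>M)
    \<le> ennreal ((real k - 1) * ((ln n + 1) / (real n - 1)) + 2 * real l * ((ln n + 1) / n))"
proof -
  interpret exponential_weights M "{1..n}" T by fact
  define d where "d \<omega> v = steiner_weight {1..n} (\<lambda>e. T e \<omega>) {1, v}" for \<omega> v
  have n1: "1 \<in> {1..n}" using n k by auto
  have ln: "ln n \<ge> 0" using n by simp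
  have [measurable]: "(\<lambda>\<omega>. d \<omega> v) \<in> borel_measurable M" for v
    unfolding d_def by (rule steiner_weight_measurable) simp
  have H: "(\<Sum>j = 1..<n. 1 / real j) \<le> ln n + 1" using n by (intro sum_inverse_le_ln) auto
  have "(\<integral>\<^sup>+\<omega>. ennreal (max_steiner_weight k l n (\<lambda>e. T e \<omega>)) \<partial>M) \<le>
    (\<integral>\<^sup>+\<omega>. (\<Sum>v = 2..k. ennreal (d \<omega> v)) + ennreal l * ennreal (Max (d \<omega> ` {1..n})) \<partial>M)"
  proof (rule nn_integral_mono_AE)
    from AE_max_steiner_weight_le[OF ew k n(1)]
    show "AE \<omega> in M. ennreal (max_steiner_weight k l n (\<lambda>e. T e \<omega>)) \<le>
      (\<Sum>v = 2..k. ennreal (d \<omega> v)) + ennreal l * ennreal (Max (d \<omega> ` {1..n}))"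
    proof eventually_elim
      case (elim \<omega>)
      have d: "0 \<le> d \<omega> v" if "v \<in> {1..n}" for v using elim that by (simp add: d_def)
      have "0 \<le> d \<omega> 1" by (rule d[OF n1])
      also have "\<dots> \<le> Max (d \<omega> ` {1..n})" using n1 by (intro Max_ge) auto
      finally have mx: "0 \<le> Max (d \<omega> ` {1..n})" .
      have "ennreal (max_steiner_weight k l n (\<lambda>e. T e \<omega>)) \<le> ennreal ((\<Sum>v = 2..k. d \<omega> v) + l * Max (d \<omega> ` {1..n}))"
        using elim by (intro ennreal_leI) (simp add: d_def[abs_def])
      also have "\<dots> = (\<Sum>v = 2..k. ennreal (d \<omega> v)) + ennreal l * ennreal (Max (d \<omega> ` {1..n}))"
      proof (subst ennreal_plus)
        show "0 \<le> (\<Sum>v = 2..k. d \<omega> v)" using n by (intro sum_nonneg d) auto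
        show "0 \<le> real l * Max (d \<omega> ` {1..n})" using mx by simp
        show "ennreal (\<Sum>v = 2..k. d \<omega> v) + ennreal (real l * Max (d \<omega> ` {1..n})) =
          (\<Sum>v = 2..k. ennreal (d \<omega> v)) + ennreal l * ennreal (Max (d \<omega> ` {1..n}))"
          using mx n by (subst sum_ennreal[symmetric]) (auto intro!: d simp: ennreal_mult)
      qed
      finally show ?case .
    qed
  qed
  also have "\<dots> = (\<Sum>v = 2..k. \<integral>\<^sup>+\<omega>. ennreal (d \<omega> v) \<partial>M) + ennreal l * (\<integral>\<^sup>+\<omega>. ennreal (Max (d \<omega> ` {1..n})) \<partial>M)"
    by (subst nn_integral_add, measurable, subst nn_integral_sum, measurable, subst nn_integral_cmult, measurable)
  also have "\<dots> \<le> (\<Sum>v = 2..k. ennreal ((ln n + 1) / (real n - 1))) + ennreal l * ennreal (2 * (ln n + 1) / n)"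
  proof (intro add_mono sum_mono mult_left_mono)
    fix v assume "v \<in> {2..k}"
    then have "(\<integral>\<^sup>+\<omega>. ennreal (d \<omega> v) \<partial>M) \<le> ennreal ((\<Sum>j = 1..<n. 1 / real j) / (real n - 1))"
      using nn_integral_dist[OF n1, of v] n by (simp add: d_def)
    also have "\<dots> \<le> ennreal ((ln n + 1) / (real n - 1))"
      using H n(2) by (intro ennreal_leI divide_right_mono) simp_all
    finally show "(\<integral>\<^sup>+\<omega>. ennreal (d \<omega> v) \<partial>M) \<le> ennreal ((ln n + 1) / (real n - 1))" .
  next
    have "(\<integral>\<^sup>+\<omega>. ennreal (Max (d \<omega> ` {1..n})) \<partial>M) \<le> ennreal (2 * (\<Sum>j = 1..<n. 1 / real j) / n)"
      using nn_integral_max_dist[OF n1] sum_inverse_prod[of n] by (simp add: d_def[abs_def])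
    also have "\<dots> \<le> ennreal (2 * (ln n + 1) / n)"
      using H n by (intro ennreal_leI divide_right_mono mult_left_mono) auto
    finally show "(\<integral>\<^sup>+\<omega>. ennreal (Max (d \<omega> ` {1..n})) \<partial>M) \<le> ennreal (2 * (ln n + 1) / n)" .
  qed auto
  also have "\<dots> = ennreal ((real k - 1) * ((ln n + 1) / (real n - 1)) + 2 * real l * ((ln n + 1) / n))"
  proof -
    have "(\<Sum>v = 2..k. ennreal ((ln n + 1) / (real n - 1))) = ennreal ((real k - 1) * ((ln n + 1) / (real n - 1)))"
      using k n ln by (subst sum_ennreal) (auto simp: of_nat_diff)
    moreover have "ennreal l * ennreal (2 * (ln n + 1) / n) = ennreal (2 * real l * ((ln n + 1) / n))"
      using ln by (subst ennreal_mult[symmetric]) (auto simp: mult_ac)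
    moreover have "0 \<le> (real k - 1) * ((ln n + 1) / (real n - 1))" "0 \<le> 2 * real l * ((ln n + 1) / n)"
      using k n ln by auto
    ultimately show ?thesis by (simp add: ennreal_plus)
  qed
  finally show ?thesis .
qed

theorem theorem4:
  fixes k l :: nat
    and M :: "nat \<Rightarrow> 'a measure"
    and T :: "nat \<Rightarrow> nat set \<Rightarrow> 'a \<Rightarrow> real"
  assumes "k > 0" and "l > 0"
    and "\<And>n. n \<ge> k + l \<Longrightarrow> prob_space (M n)"
    and "\<And>n. n \<ge> k + l \<Longrightarrow>
           prob_space.indep_vars (M n) (\<lambda>_. borel) (T n) (complete_edges {1..n})"
    and "\<And>n e. n \<ge> k + l \<Longrightarrow> e \<in> complete_edges {1..n} \<Longrightarrow>
           distributed (M n) lborel (T n e) (exponential_density 1)"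
  shows "converges_in_prob M
           (\<lambda>n \<omega>. max_steiner_weight k l n (\<lambda>e. T n e \<omega>) / (ln (real n) / real n))
           (real k + 2 * real l - 1)"
proof -
  have ew: "exponential_weights (M n) {1..n} (T n)" if "n \<ge> k + l" for n
    using assms(3-5)[OF that]
    by (intro exponential_weights.intro exponential_weights_axioms.intro) auto
  define L where "L n = ln (real n) / real n" for n :: nat
  define W where "W n \<omega> = max_steiner_weight k l n (\<lambda>e. T n e \<omega>)" for n \<omega>
  define c where "c = real k + 2 * real l - 1"
  have L: "L n > 0" if "n \<ge> k + l" for n using that assms(1,2) by (simp add: L_def)
  have Wmeas: "W n \<in> borel_measurable (M n)" if "n \<ge> k + l" for n
  proof -
    interpret exponential_weights "M n" "{1..n}" "T n" by (rule ew[OF that])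
    show ?thesis unfolding W_def[abs_def] max_steiner_weight_eq
      by (intro borel_measurable_Max finite_terminal_sets steiner_weight_measurable) auto
  qed
  have "converges_in_prob M (\<lambda>n \<omega>. W n \<omega> / L n) c"
  proof (rule converges_in_prob_one_sided)
    show "\<forall>\<^sub>F n in sequentially. prob_space (M n)"
      using eventually_ge_at_top[of "k + l"] by eventually_elim (rule assms(3))
    show "\<forall>\<^sub>F n in sequentially. (\<lambda>\<omega>. W n \<omega> / L n) \<in> borel_measurable (M n)"
      using eventually_ge_at_top[of "k + l"] by eventually_elim (intro borel_measurable_divide Wmeas borel_measurable_const)
    show "\<forall>\<^sub>F n in sequentially. AE \<omega> in M n. 0 \<le> W n \<omega> / L n"
      using eventually_ge_at_top[of "k + l"]
    proof eventually_elim
      case (elim n)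
      from AE_max_steiner_weight_le[OF ew[OF elim] assms(1) elim] show ?case
        by eventually_elim (use L[OF elim] in \<open>simp add: W_def\<close>)
    qed
    define u where "u n = ((real k - 1) * ((ln (real n) + 1) / (real n - 1)) + 2 * real l * ((ln (real n) + 1) / real n)) / L n" for n :: nat
    show "\<forall>\<^sub>F n in sequentially. (\<integral>\<^sup>+\<omega>. ennreal (W n \<omega> / L n) \<partial>M n) \<le> ennreal (u n)"
      using eventually_ge_at_top[of "k + l"]
    proof eventually_elim
      case (elim n)
      have n2: "n \<ge> 2" using elim assms(1,2) by simp
      have "(\<integral>\<^sup>+\<omega>. ennreal (W n \<omega> / L n) \<partial>M n) = (\<integral>\<^sup>+\<omega>. ennreal (1 / L n) * ennreal (W n \<omega>) \<partial>M n)"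
        using L[OF elim] by (intro nn_integral_cong) (simp add: ennreal_mult'[symmetric])
      also have "\<dots> = ennreal (1 / L n) * (\<integral>\<^sup>+\<omega>. ennreal (W n \<omega>) \<partial>M n)"
        using Wmeas[OF elim] by (intro nn_integral_cmult) simp
      also have "\<dots> \<le> ennreal (1 / L n) * ennreal ((real k - 1) * ((ln (real n) + 1) / (real n - 1)) + 2 * real l * ((ln (real n) + 1) / real n))"
        using nn_integral_max_steiner_weight[OF ew[OF elim] assms(1) elim n2]
        by (intro mult_left_mono) (auto simp: W_def)
      also have "\<dots> = ennreal (u n)"
        using L[OF elim] by (subst ennreal_mult'[symmetric]) (auto simp: u_def)
      finally show ?case .
    qed
    \<comment> \<open>Both quotients tend to 1: the added 1 from the harmonic sum and n - 1 in place
      of n are of lower order.\<close>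
    have "(\<lambda>n. (real k - 1) * ((ln (real n) + 1) / (real n - 1) / L n) + 2 * real l * ((ln (real n) + 1) / real n / L n))
        \<longlonglongrightarrow> (real k - 1) * 1 + 2 * real l * 1"
      unfolding L_def by (intro tendsto_add tendsto_mult tendsto_const) real_asymp+
    then show "u \<longlonglongrightarrow> c" by (simp add: u_def[abs_def] c_def add_divide_distrib algebra_simps)
    show "c > 0" using assms(1,2) by (simp add: c_def)
    fix \<theta> :: real assume \<theta>: "0 < \<theta>" "\<theta> < 1"
    define i where "i = k - 1 + l"
    define C where "C = (\<Sum>e. (1 / (1 + \<theta>)) ^ e * real (e + 1) ^ (4 * i))"
    have C: "(\<Sum>e<N. (1 / (1 + \<theta>)) ^ e * real (e + 1) ^ (4 * i)) \<le> C" for N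
      unfolding C_def using \<theta> by (intro sum_le_suminf summable_poly_geometric) auto
    define a where "a n = (1 - \<theta>) * ln (real n) / real n" for n :: nat
    define m where "m n = (real n - real k) * exp (- a n * (real n - 1))" for n
    define b where "b n = 4 / m n + 4 * (exp (2 * a n) - 1) + C * exp (- \<theta>\<^sup>2 * real i * ln (real n)) * (2 * real l) ^ l * exp (a n * real l ^ 2)" for n
    have a_lim: "a \<longlonglongrightarrow> 0" unfolding a_def using \<theta> by real_asymp
    \<comment> \<open>The expected number of special vertices grows like n^\<theta>, so it
      eventually exceeds 2 l.\<close>
    have m_lim: "filterlim m at_top sequentially"
    proof (rule filterlim_cong[THEN iffD1, OF refl refl])
      have "filterlim (\<lambda>n. real n powr \<theta>) at_top sequentially" using \<theta> by real_asymp
      moreover have "(\<lambda>n. (real n - real k) / real n * exp (a n)) \<longlonglongrightarrow> 1 * exp 0"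
        by (intro tendsto_mult tendsto_exp a_lim) real_asymp
      ultimately show "filterlim (\<lambda>n. (real n - real k) / real n * exp (a n) * real n powr \<theta>) at_top sequentially"
        by (intro filterlim_tendsto_pos_mult_at_top) auto
      show "\<forall>\<^sub>F n in sequentially. (real n - real k) / real n * exp (a n) * real n powr \<theta> = m n"
        using eventually_gt_at_top[of 0]
      proof eventually_elim
        case (elim n)
        have "- a n * (real n - 1) = a n + \<theta> * ln (real n) - ln (real n)"
          using elim by (simp add: a_def field_simps)
        then show ?case using elim by (simp add: m_def exp_diff exp_add powr_def)
      qed
    qed
    have "(\<lambda>n. exp (- \<theta>\<^sup>2 * real i * ln (real n))) \<longlonglongrightarrow> 0"
    proof -
      have "\<theta>\<^sup>2 * real i > 0" using \<theta> assms(2) by (simp add: i_def)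
      then show ?thesis by real_asymp
    qed
    moreover have "(\<lambda>n. 4 / m n) \<longlonglongrightarrow> 0"
      by (rule tendsto_divide_0[OF tendsto_const filterlim_at_top_imp_at_infinity[OF m_lim]])
    ultimately have "b \<longlonglongrightarrow> 0 + 4 * (exp (2 * 0) - 1) + C * 0 * (2 * real l) ^ l * exp (0 * real l ^ 2)"
      unfolding b_def by (intro tendsto_intros a_lim)
    then have b_lim: "b \<longlonglongrightarrow> 0" by simp
    show "(\<lambda>n. measure (M n) {\<omega> \<in> space (M n). W n \<omega> / L n \<le> (1 - \<theta>) * c}) \<longlonglongrightarrow> 0"
    proof (rule tendsto_sandwich[OF _ _ tendsto_const b_lim])
      have "\<forall>\<^sub>F n in sequentially. m n \<ge> 2 * real l"
        using m_lim by (simp add: filterlim_at_top)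
      then show "\<forall>\<^sub>F n in sequentially. measure (M n) {\<omega> \<in> space (M n). W n \<omega> / L n \<le> (1 - \<theta>) * c} \<le> b n"
        using eventually_ge_at_top[of "k + l"]
      proof eventually_elim
        case (elim n)
        have "W n \<omega> / L n \<le> (1 - \<theta>) * c \<longleftrightarrow> W n \<omega> \<le> (1 - \<theta>) * c * L n" for \<omega>
          using L[OF elim(2)] by (simp add: divide_le_eq)
        then show ?case
          using prob_max_steiner_weight_le[OF ew[OF elim(2)] assms(1,2) elim(2) \<theta> C[unfolded i_def]] elim(1)
          by (simp add: b_def m_def a_def i_def W_def c_def L_def)
      qed
    qed auto
  qed
  then show ?thesis by (simp add: W_def L_def c_def)
qed

end
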